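(* Let $m\ge n\ge 3$. Then \[\operatorname{M}(C_n\,\Box\, C_m)=\operatorname{Z}(C_n\,\Box\, C_m)= \begin{cases} 2n-1 & \text{if $m=n$ and $n$ is odd,}\\ 2n & \text{otherwise.} \end{cases}\]
   Context: All graphs are finite, simple and undirected. $C_k$ is the cycle on $k$ vertices. The Cartesian product $G\,\Box\, H$ has vertex set $V(G)\times V(H)$, with $(g,h)$ adjacent to $(g',h')$ iff either $g=g'$ and $h\sim h'$ in $H$, or $h=h'$ and $g\sim g'$ in $G$. For a graph $G$ on vertex set $\{1,\dots,N\}$, $\mathcal{S}(G)$ is the set of real symmetric $N\times N$ matrices $A=[a_{ij}]$ such that for $i\neq j$, $a_{ij}\neq 0$ iff $\{i,j\}$ is an edge of $G$ (diagonal entries are arbitrary); the maximum nullity is $\operatorname{M}(G)=\max\{\operatorname{null} A: A\in\mathcal{S}(G)\}$. Zero forcing: vertices are colored blue or white; if a blue vertex $u$ has exactly one white neighbor $w$, then $w$ is changed to blue. A zero forcing set is a set $B$ of vertices such that, coloring $B$ blue and all others white, repeated application of this rule colors all vertices blue; $\operatorname{Z}(G)$ is the minimum cardinality of a zero forcing set. *)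

theory Defs
  imports "Jordan_Normal_Form.Matrix_Kernel"
begin

record 'a ugraph =
  verts :: "'a set"
  edges :: "'a set set"

definition simple_graph :: "'a ugraph \<Rightarrow> bool" where
  "simple_graph G \<longleftrightarrow> finite (verts G) \<and>
     (\<forall>e \<in> edges G. \<exists>u \<in> verts G. \<exists>v \<in> verts G. u \<noteq> v \<and> e = {u, v})"

abbreviation adj :: "'a ugraph \<Rightarrow> 'a \<Rightarrow> 'a \<Rightarrow> bool" where
  "adj G u v \<equiv> {u, v} \<in> edges G"

text \<open>This is the cycle on \<open>k\<close> vertices only for \<open>k \<ge> 3\<close>.\<close>

definition cycle_graph :: "nat \<Rightarrow> nat ugraph" where
  "cycle_graph k = \<lparr>verts = {..<k}, edges = {{i, (i + 1) mod k} | i. i < k}\<rparr>"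

definition box_prod :: "'a ugraph \<Rightarrow> 'b ugraph \<Rightarrow> ('a \<times> 'b) ugraph"  (infixl \<open>\<box>\<close> 70) where
  "G \<box> H = \<lparr>verts = verts G \<times> verts H,
     edges = {{(g, h), (g', h')} | g h g' h'.
       (g, h) \<in> verts G \<times> verts H \<and> (g', h') \<in> verts G \<times> verts H \<and>
       (g = g' \<and> adj H h h' \<or> h = h' \<and> adj G g g')}\<rparr>"

text \<open>
  The rows and columns of a matrix are numbered from \<open>0\<close>, so a graph on an arbitrary vertex set
  is first identified with a graph on \<open>{..<N}\<close> by a labelling. Two labellings give
  permutation-similar matrices, hence the same nullities.
\<close>

definition labelling :: "'a ugraph \<Rightarrow> (nat \<Rightarrow> 'a) \<Rightarrow> bool" where
  "labelling G f \<longleftrightarrow> bij_betw f {..<card (verts G)} (verts G)"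

definition sym_matrices :: "'a ugraph \<Rightarrow> (nat \<Rightarrow> 'a) \<Rightarrow> real mat set" where
  "sym_matrices G f = {A \<in> carrier_mat (card (verts G)) (card (verts G)).
     A\<^sup>T = A \<and>
     (\<forall>i < card (verts G). \<forall>j < card (verts G). i \<noteq> j \<longrightarrow> (A $$ (i, j) \<noteq> 0 \<longleftrightarrow> adj G (f i) (f j)))}"

definition max_nullity :: "'a ugraph \<Rightarrow> nat" where
  "max_nullity G = Max {kernel_dim A | A f. labelling G f \<and> A \<in> sym_matrices G f}"

text \<open>A colouring is represented by its set of blue vertices.\<close>

definition force_step :: "'a ugraph \<Rightarrow> 'a set \<Rightarrow> 'a set \<Rightarrow> bool" where
  "force_step G B B' \<longleftrightarrow>
     (\<exists>u \<in> B. \<exists>w. {v \<in> verts G. adj G u v \<and> v \<notin> B} = {w} \<and> B' = insert w B)"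

definition zero_forcing_set :: "'a ugraph \<Rightarrow> 'a set \<Rightarrow> bool" where
  "zero_forcing_set G B \<longleftrightarrow> B \<subseteq> verts G \<and> (force_step G)\<^sup>*\<^sup>* B (verts G)"

definition zero_forcing_number :: "'a ugraph \<Rightarrow> nat" where
  "zero_forcing_number G = Min {card B | B. zero_forcing_set G B}"

lemma simple_graph_cycle_graph:
  assumes "k \<ge> 3"
  shows "simple_graph (cycle_graph k)"
proof -
  have "i \<noteq> (i + 1) mod k" "(i + 1) mod k < k" if "i < k" for i
    using that assms by (auto simp: mod_if)
  then show ?thesis
    unfolding simple_graph_def cycle_graph_def by fastforce
qed

lemma adj_cycle_graph:
  "adj (cycle_graph k) i j \<longleftrightarrow> i < k \<and> j < k \<and> (j = (i + 1) mod k \<or> i = (j + 1) mod k)"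
  by (auto simp: cycle_graph_def doubleton_eq_iff)

lemma simple_graph_box_prod:
  assumes "simple_graph G" "simple_graph H"
  shows "simple_graph (G \<box> H)"
proof -
  have irr: "\<not> adj G g g" "\<not> adj H h h" for g h
    using assms by (auto simp: simple_graph_def doubleton_eq_iff)
  have fin: "finite (verts G \<times> verts H)"
    using assms by (simp add: simple_graph_def)
  have "\<exists>u \<in> verts G \<times> verts H. \<exists>v \<in> verts G \<times> verts H. u \<noteq> v \<and> e = {u, v}"
    if "e \<in> edges (G \<box> H)" for e
  proof -
    from that obtain g h g' h' where e: "e = {(g, h), (g', h')}"
      "(g, h) \<in> verts G \<times> verts H" "(g', h') \<in> verts G \<times> verts H"
      "g = g' \<and> adj H h h' \<or> h = h' \<and> adj G g g'"
      by (auto simp: box_prod_def)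
    then have "(g, h) \<noteq> (g', h')" using irr by auto
    with e show ?thesis by blast
  qed
  with fin show ?thesis
    by (simp add: simple_graph_def box_prod_def)
qed

lemma adj_box_prod:
  "adj (G \<box> H) (g, h) (g', h') \<longleftrightarrow>
    (g, h) \<in> verts (G \<box> H) \<and> (g', h') \<in> verts (G \<box> H) \<and>
    (g = g' \<and> adj H h h' \<or> h = h' \<and> adj G g g')"
  by (auto simp: box_prod_def doubleton_eq_iff insert_commute)

lemma finite_nullities:
  "finite {kernel_dim A | A f. labelling G f \<and> A \<in> sym_matrices G f}"
proof (rule finite_subset)
  show "{kernel_dim A | A f. labelling G f \<and> A \<in> sym_matrices G f} \<subseteq> {..card (verts G)}"
  proof clarify
    fix A f assume "A \<in> sym_matrices G f"
    then have A: "A \<in> carrier_mat (card (verts G)) (card (verts G))"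
      by (simp add: sym_matrices_def)
    then show "kernel_dim A \<le> card (verts G)"
      by (simp add: kernel_dim_code)
  qed
qed simp

lemma nullities_nonempty:
  assumes "simple_graph G"
  shows "{kernel_dim A | A f. labelling G f \<and> A \<in> sym_matrices G f} \<noteq> {}"
proof -
  let ?N = "card (verts G)"
  obtain f where f: "labelling G f"
    using assms ex_bij_betw_nat_finite[of "verts G"]
    by (auto simp: simple_graph_def labelling_def atLeast0LessThan)
  let ?A = "mat ?N ?N (\<lambda>(i, j). if adj G (f i) (f j) then 1 else 0 :: real)"
  have "?A \<in> sym_matrices G f"
    by (auto simp: sym_matrices_def insert_commute)
  with f show ?thesis by blast
qed

lemma zero_forcing_cards:
  assumes "simple_graph G"
  shows "finite {card B | B. zero_forcing_set G B}" "{card B | B. zero_forcing_set G B} \<noteq> {}"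
proof -
  have "finite (card ` Pow (verts G))"
    using assms by (simp add: simple_graph_def)
  then show "finite {card B | B. zero_forcing_set G B}"
    by (rule rev_finite_subset) (auto simp: zero_forcing_set_def)
  have "zero_forcing_set G (verts G)"
    by (simp add: zero_forcing_set_def)
  then show "{card B | B. zero_forcing_set G B} \<noteq> {}" by blast
qed

end

theory Submission
  imports Defs
begin

text \<open>
  The chain of inequalities is value \<open>\<le>\<close> maximum nullity \<open>\<le>\<close> zero forcing number \<open>\<le>\<close> value.

  A kernel vector that vanishes on a zero forcing set vanishes everywhere, which gives the middle
  inequality. Two adjacent copies of \<open>C\<^sub>n\<close> form a zero forcing set. If \<open>m = n = 2h + 1\<close>, one vertex can be
  omitted: the blue region then spreads outside a light cone issuing from the missing vertex,
  and this region contains two full adjacent cycles in the other direction.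

  For the lower bound, every \<open>C\<^sub>N\<close> has a matrix whose eigenvalues, listed with multiplicity, are
  \<open>k div 2\<close> for \<open>k < N\<close>. If \<open>A\<close> and \<open>B\<close> are such matrices for \<open>C\<^sub>n\<close> and \<open>C\<^sub>m\<close>, the kernel of
  \<open>I \<otimes> B - A \<otimes> I\<close> contains the tensor products of eigenvectors for equal eigenvalues, and counting the
  pairs \<open>(k, l)\<close> with \<open>k div 2 = l div 2\<close> gives the value. The matrix for \<open>C\<^sub>N\<close> is an arrow matrix
  (a diagonal matrix bordered by one row and column), written in the basis of orthonormal polynomials
  on its diagonal entries: the diagonal part becomes a Jacobi matrix, that is, a path, and the
  border is a combination of the first and the last basis vector, which closes the path to a cycle.
\<close>

section \<open>Nullity and zero forcing\<close>

text \<open>A homogeneous system with fewer equations than unknowns has a nontrivial solution.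
  Gaussian elimination: an unknown \<open>v0\<close> occurring in equation \<open>i\<close> is
  eliminated from the others.\<close>

lemma exists_linear_relation:
  fixes F :: "'a \<Rightarrow> 'b \<Rightarrow> 'c :: field"
  assumes "finite I" "finite b" "card I < card b"
  shows "\<exists>c. (\<exists>v\<in>b. c v \<noteq> 0) \<and> (\<forall>i\<in>I. (\<Sum>v\<in>b. c v * F v i) = 0)"
  using assms
proof (induction I arbitrary: b F rule: finite_induct)
  case empty
  then have "b \<noteq> {}" by auto
  then show ?case by (intro exI[of _ "\<lambda>_. 1"]) auto
next
  case (insert i I)
  show ?case
  proof (cases "\<forall>v\<in>b. F v i = 0")
    case True
    obtain c where "\<exists>v\<in>b. c v \<noteq> 0" "\<forall>j\<in>I. (\<Sum>v\<in>b. c v * F v j) = 0"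
      using insert.IH[of b F] insert.prems insert.hyps by auto
    with True show ?thesis by (intro exI[of _ c]) auto
  next
    case False
    then obtain v0 where v0: "v0 \<in> b" "F v0 i \<noteq> 0" by auto
    let ?b = "b - {v0}"
    have "card I < card ?b" using insert.prems insert.hyps v0 by auto
    then obtain c where c: "\<exists>v\<in>?b. c v \<noteq> 0"
      "\<forall>j\<in>I. (\<Sum>v\<in>?b. c v * (F v j - F v i / F v0 i * F v0 j)) = 0"
      using insert.IH[of ?b "\<lambda>v j. F v j - F v i / F v0 i * F v0 j"] insert.prems by auto
    \<comment> \<open>Back substitution: the coefficient of \<open>v0\<close> is solved from
      equation \<open>i\<close>. The eliminated system was formed so that this choice also satisfies
      the equations in \<open>I\<close>.\<close>
    define d where "d v = (if v = v0 then - (\<Sum>v\<in>?b. c v * F v i) / F v0 i else c v)" for v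
    have split: "(\<Sum>v\<in>b. d v * F v j) = - (\<Sum>v\<in>?b. c v * F v i) / F v0 i * F v0 j + (\<Sum>v\<in>?b. c v * F v j)" for j
    proof -
      have "(\<Sum>v\<in>b. d v * F v j) = d v0 * F v0 j + (\<Sum>v\<in>?b. d v * F v j)"
        using v0 insert.prems by (intro sum.remove) auto
      also have "(\<Sum>v\<in>?b. d v * F v j) = (\<Sum>v\<in>?b. c v * F v j)"
        by (intro sum.cong) (auto simp: d_def)
      finally show ?thesis by (simp add: d_def)
    qed
    have "(\<Sum>v\<in>b. d v * F v j) = 0" if "j \<in> insert i I" for j
    proof (cases "j = i")
      case True
      then show ?thesis using split[of i] v0 by simp
    next
      case False
      with that have "(\<Sum>v\<in>?b. c v * (F v j - F v i / F v0 i * F v0 j)) = 0" using c by auto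
      then have "(\<Sum>v\<in>?b. c v * F v j) - (\<Sum>v\<in>?b. c v * F v i) / F v0 i * F v0 j = 0"
        by (simp add: algebra_simps sum_subtractf sum_distrib_left sum_distrib_right sum_divide_distrib)
      then show ?thesis using split[of j] by simp
    qed
    moreover have "\<exists>v\<in>b. d v \<noteq> 0" using c(1) by (auto simp: d_def)
    ultimately show ?thesis by blast
  qed
qed

text \<open>If a kernel basis had more than \<open>card I\<close> vectors, some nontrivial
  combination would vanish on all of \<open>I\<close>, hence everywhere, against
  independence.\<close>

lemma kernel_dim_le_card:
  fixes A :: "'a :: field mat"
  assumes A: "A \<in> carrier_mat N N" and I: "I \<subseteq> {..<N}"
    and det: "\<And>x. x \<in> carrier_vec N \<Longrightarrow> A *\<^sub>v x = 0\<^sub>v N \<Longrightarrow> (\<And>i. i \<in> I \<Longrightarrow> x $ i = 0) \<Longrightarrow> x = 0\<^sub>v N"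
  shows "kernel_dim A \<le> card I"
proof (rule ccontr)
  assume less: "\<not> kernel_dim A \<le> card I"
  interpret kernel N N A by unfold_locales (rule A)
  obtain b where b: "finite b" "basis b" using kernel_basis_exists[OF A] by auto
  then have bk: "b \<subseteq> mat_kernel A" and li: "lin_indpt b"
    unfolding Ker.basis_def by auto
  have "card b = kernel_dim A" using Ker.dim_basis[OF b] by simp
  then have "card I < card b" using less by simp
  then obtain c where c: "\<exists>v\<in>b. c v \<noteq> 0" "\<forall>i\<in>I. (\<Sum>v\<in>b. c v * v $ i) = 0"
    using exists_linear_relation[of I b "\<lambda>v i. v $ i"] b finite_subset[OF I] by auto
  have "lincomb c b \<in> mat_kernel A" using bk by (intro Ker.lincomb_closed) auto
  then have "lincomb c b \<in> carrier_vec N" "A *\<^sub>v lincomb c b = 0\<^sub>v N"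
    unfolding mat_kernel[OF A] by blast+
  moreover have "lincomb c b $ i = 0" if "i \<in> I" for i
    using that c(2) I lincomb_index[OF _ bk, of i c] by auto
  ultimately have "lincomb c b = 0\<^sub>v N"
    by (rule det)
  then have "lin_dep b" using c(1) b(1) unfolding Ker.lin_dep_def by auto
  with li show False by simp
qed

text \<open>Nonzero pairwise orthogonal vectors are independent. The equivalence in
  \<open>ortho\<close> covers both properties: for \<open>s = t\<close> it says that
  \<open>X s\<close> is nonzero.\<close>

lemma card_le_kernel_dim:
  fixes A :: "real mat"
  assumes A: "A \<in> carrier_mat N N"
    and X: "\<And>s. s \<in> S \<Longrightarrow> X s \<in> carrier_vec N" "\<And>s. s \<in> S \<Longrightarrow> A *\<^sub>v X s = 0\<^sub>v N"
    and ortho: "\<And>s t. s \<in> S \<Longrightarrow> t \<in> S \<Longrightarrow> X s \<bullet> X t = 0 \<longleftrightarrow> s \<noteq> t"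
  shows "card S \<le> kernel_dim A"
proof -
  interpret kernel N N A by unfold_locales (rule A)
  have inj: "inj_on X S" using ortho by (metis inj_onI)
  have sub: "X ` S \<subseteq> mat_kernel A" using X by (auto simp: mat_kernel[OF A])
  have "lin_indpt (X ` S)"
  proof
    assume "lin_dep (X ` S)"
    then obtain U a v where U: "finite U" "U \<subseteq> X ` S" "lincomb a U = 0\<^sub>v N" "v \<in> U" "a v \<noteq> 0"
      unfolding Ker.lin_dep_def by auto
    have v: "v \<in> carrier_vec N" using U X by auto
    have "0 = (\<Sum>i<N. lincomb a U $ i * v $ i)" using U(3) by simp
    also have "\<dots> = (\<Sum>i<N. (\<Sum>x\<in>U. a x * x $ i) * v $ i)"
      using lincomb_index[of _ U a] U(2) sub by (intro sum.cong) auto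
    also have "\<dots> = (\<Sum>x\<in>U. a x * (\<Sum>i<N. x $ i * v $ i))"
      by (simp add: sum_distrib_right sum_distrib_left mult.assoc) (rule sum.swap)
    also have "\<dots> = (\<Sum>x\<in>U. a x * (x \<bullet> v))"
      using v by (simp add: scalar_prod_def atLeast0LessThan)
    also have "\<dots> = (\<Sum>x\<in>{v}. a x * (x \<bullet> v))"
    proof (intro sum.mono_neutral_right ballI)
      fix x assume "x \<in> U - {v}"
      then obtain s t where "s \<in> S" "t \<in> S" "x = X s" "v = X t" "s \<noteq> t" using U by blast
      then show "a x * (x \<bullet> v) = 0" using ortho by simp
    qed (use U in auto)
    finally have "v \<bullet> v = 0" using U(5) by simp
    moreover obtain s where "s \<in> S" "v = X s" using U by blast
    ultimately show False using ortho[of s s] by simp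
  qed
  moreover have "Ker.fin_dim"
    using kernel_basis_exists[OF A] unfolding Ker.fin_dim_def Ker.basis_def by auto
  ultimately show ?thesis
    using Ker.li_le_dim(2)[OF _ sub] card_image[OF inj] by simp
qed

text \<open>If \<open>u\<close> forces \<open>w\<close>, the row of \<open>A\<close> at
  \<open>u\<close> applied to \<open>x\<close> reduces to the single term at \<open>w\<close>, whose
  coefficient is nonzero.\<close>

lemma force_step_kernel_zero:
  assumes f: "labelling G f" and A: "A \<in> sym_matrices G f"
    and x: "x \<in> carrier_vec (card (verts G))" "A *\<^sub>v x = 0\<^sub>v (card (verts G))"
    and step: "force_step G B B'" and B: "B \<subseteq> verts G"
    and zero: "\<And>i. i < card (verts G) \<Longrightarrow> f i \<in> B \<Longrightarrow> x $ i = 0"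
  shows "i < card (verts G) \<Longrightarrow> f i \<in> B' \<Longrightarrow> x $ i = 0"
proof -
  let ?N = "card (verts G)"
  assume i: "i < ?N" "f i \<in> B'"
  obtain u w where uw: "u \<in> B" "{v \<in> verts G. adj G u v \<and> v \<notin> B} = {w}" "B' = insert w B"
    using step by (auto simp: force_step_def)
  show "x $ i = 0"
  proof (cases "f i \<in> B")
    case False
    have bij: "bij_betw f {..<?N} (verts G)" using f by (simp add: labelling_def)
    have fi: "f i = w" using i(2) uw(3) False by blast
    have "u \<in> f ` {..<?N}" using bij_betw_imp_surj_on[OF bij] uw(1) B by blast
    then obtain j where j: "j < ?N" "f j = u" by blast
    have Ac: "A \<in> carrier_mat ?N ?N" and pat: "\<And>k l. k < ?N \<Longrightarrow> l < ?N \<Longrightarrow> k \<noteq> l \<Longrightarrow> A $$ (k, l) \<noteq> 0 \<longleftrightarrow> adj G (f k) (f l)"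
      using A unfolding sym_matrices_def by blast+
    have ji: "j \<noteq> i" using False j uw(1) by metis
    \<comment> \<open>At a blue vertex \<open>x\<close> vanishes, and \<open>u\<close> itself is
      blue, so the arbitrary diagonal entry is harmless. A white vertex other than \<open>w\<close>
      is not adjacent to \<open>u\<close>.\<close>
    have "A $$ (j, l) * x $ l = 0" if l: "l < ?N" "l \<noteq> i" for l
    proof (cases "l = j \<or> f l \<in> B")
      case True
      then have "f l \<in> B" using j(2) uw(1) by metis
      then show ?thesis using zero l by simp
    next
      case False
      have "f l \<noteq> w"
        using inj_onD[OF bij_betw_imp_inj_on[OF bij], of l i] l i(1) fi by auto
      moreover have "f l \<in> verts G" using bij_betwE[OF bij] l by blast
      ultimately have "\<not> adj G u (f l)" using uw(2) False by blast
      then have "A $$ (j, l) = 0" using pat[of j l] False l(1) j by metis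
      then show ?thesis by simp
    qed
    then have "(\<Sum>l<?N. A $$ (j, l) * x $ l) = (\<Sum>l\<in>{i}. A $$ (j, l) * x $ l)"
      using i by (intro sum.mono_neutral_right) auto
    moreover have "(\<Sum>l<?N. A $$ (j, l) * x $ l) = (A *\<^sub>v x) $ j"
      using Ac x(1) j(1) by (simp add: scalar_prod_def atLeast0LessThan)
    ultimately have "A $$ (j, i) * x $ i = 0" using x j by simp
    moreover have "A $$ (j, i) \<noteq> 0" using pat[of j i] ji i j fi uw(2) by blast
    ultimately show ?thesis by simp
  qed (use zero i in auto)
qed

text \<open>Vanishing on \<open>B\<close> propagates along the forcing sequence to all vertices, so
  the coordinates labelled by \<open>B\<close> determine a kernel vector.\<close>

lemma kernel_dim_le_zero_forcing:
  assumes f: "labelling G f" and A: "A \<in> sym_matrices G f"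
    and B: "zero_forcing_set G B"
  shows "kernel_dim A \<le> card B"
proof -
  let ?N = "card (verts G)"
  have bij: "bij_betw f {..<?N} (verts G)" using f by (simp add: labelling_def)
  have Bv: "B \<subseteq> verts G" and star: "(force_step G)\<^sup>*\<^sup>* B (verts G)"
    using B by (auto simp: zero_forcing_set_def)
  let ?I = "{i. i < ?N \<and> f i \<in> B}"
  have "bij_betw f ?I B"
    using bij Bv unfolding bij_betw_def by (auto simp: inj_on_def)
  then have "card ?I = card B" by (rule bij_betw_same_card)
  moreover have "kernel_dim A \<le> card ?I"
  proof (rule kernel_dim_le_card)
    show "A \<in> carrier_mat ?N ?N" using A by (simp add: sym_matrices_def)
    fix x assume x: "x \<in> carrier_vec ?N" "A *\<^sub>v x = 0\<^sub>v ?N" "\<And>i. i \<in> ?I \<Longrightarrow> x $ i = 0"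
    have "C \<subseteq> verts G \<and> (\<forall>i<?N. f i \<in> C \<longrightarrow> x $ i = 0)" if "(force_step G)\<^sup>*\<^sup>* B C" for C
      using that
    proof induction
      case (step C D)
      have "D \<subseteq> verts G" using step by (auto simp: force_step_def)
      moreover have "\<forall>i<?N. f i \<in> D \<longrightarrow> x $ i = 0"
        using force_step_kernel_zero[OF f A x(1,2) step.hyps(2)] step.IH by blast
      ultimately show ?case by blast
    qed (use Bv x in auto)
    from this[OF star] show "x = 0\<^sub>v ?N"
      using bij x(1) by (intro eq_vecI) (auto simp: bij_betw_def)
  qed auto
  ultimately show ?thesis by simp
qed

lemma max_nullity_le_zero_forcing_number:
  assumes "simple_graph G"
  shows "max_nullity G \<le> zero_forcing_number G"
  unfolding max_nullity_def
proof (rule Max.boundedI[OF finite_nullities nullities_nonempty[OF assms]])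
  fix d assume "d \<in> {kernel_dim A |A f. labelling G f \<and> A \<in> sym_matrices G f}"
  then obtain A f where A: "d = kernel_dim A" "labelling G f" "A \<in> sym_matrices G f" by blast
  show "d \<le> zero_forcing_number G"
    unfolding zero_forcing_number_def
    using kernel_dim_le_zero_forcing[OF A(2,3)] A(1)
    by (intro Min.boundedI[OF zero_forcing_cards[OF assms]]) auto
qed

section \<open>Zero forcing sets of the torus\<close>

text \<open>Forcing without an order of moves: the least set that contains \<open>B\<close> and is
  closed under the colour change rule, so that single vertices can be shown blue one at a
  time.\<close>

inductive_set forced :: "'a ugraph \<Rightarrow> 'a set \<Rightarrow> 'a set" for G B where
  base: "v \<in> B \<Longrightarrow> v \<in> forced G B"
| step: "u \<in> forced G B \<Longrightarrow> w \<in> verts G \<Longrightarrow> adj G u w \<Longrightarrow>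
    (\<And>v. v \<in> verts G \<Longrightarrow> adj G u v \<Longrightarrow> v \<noteq> w \<Longrightarrow> v \<in> forced G B) \<Longrightarrow> w \<in> forced G B"

text \<open>Among the finitely many colourings reachable from \<open>B\<close> one is maximal. No
  force applies to it, so it is closed under the rule and contains
  \<open>forced G B\<close>.\<close>

lemma zero_forcing_set_if_forced:
  assumes fin: "finite (verts G)" and B: "B \<subseteq> verts G" and all: "verts G \<subseteq> forced G B"
  shows "zero_forcing_set G B"
proof -
  let ?R = "{C. (force_step G)\<^sup>*\<^sup>* B C}"
  have sub: "C \<subseteq> verts G" if "(force_step G)\<^sup>*\<^sup>* B C" for C
    using that by induction (use B in \<open>auto simp: force_step_def\<close>)
  then have "finite ?R" using fin by (intro finite_subset[of ?R "Pow (verts G)"]) auto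
  then obtain C where C: "C \<in> ?R" and max: "\<And>D. D \<in> ?R \<Longrightarrow> C \<subseteq> D \<Longrightarrow> C = D"
    using finite_has_maximal[of ?R] by auto
  have BC: "B \<subseteq> C"
  proof -
    have "(force_step G)\<^sup>*\<^sup>* B C" using C by simp
    then show ?thesis by induction (auto simp: force_step_def)
  qed
  have "w \<in> C" if "w \<in> forced G B" for w
    using that
  proof induction
    case (step u w)
    show ?case
    proof (rule ccontr)
      assume w: "w \<notin> C"
      then have "{v \<in> verts G. adj G u v \<and> v \<notin> C} = {w}"
        using step by blast
      then have "force_step G C (insert w C)"
        using step.IH(1) unfolding force_step_def by blast
      then have "insert w C \<in> ?R" using C by (simp add: rtranclp.rtrancl_into_rtrancl)
      with max w show False by blast
    qed
  qed (use BC in auto)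
  then have "C = verts G" using all sub C by blast
  then show ?thesis using C B by (simp add: zero_forcing_set_def)
qed

lemma zero_forcing_number_le:
  assumes G: "simple_graph G" and B: "B \<subseteq> verts G" "verts G \<subseteq> forced G B"
  shows "zero_forcing_number G \<le> card B"
proof -
  have "zero_forcing_set G B"
    using G B by (intro zero_forcing_set_if_forced) (simp_all add: simple_graph_def)
  then show ?thesis
    unfolding zero_forcing_number_def using zero_forcing_cards[OF G] by (intro Min_le) blast+
qed

lemma verts_torus: "verts (cycle_graph n \<box> cycle_graph m) = {..<n} \<times> {..<m}"
  by (simp add: box_prod_def cycle_graph_def)

lemma eq_Suc_mod_iff:
  fixes i j k :: nat
  assumes "i < k" "j < k"
  shows "i = (j + 1) mod k \<longleftrightarrow> i = j + 1 \<or> i = 0 \<and> j + 1 = k"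
  using assms by (auto simp: mod_if)

text \<open>Without \<open>mod\<close>, adjacency questions become linear arithmetic with an
  explicit case for the seam of the cycle.\<close>

lemma adj_cycle_graph_iff:
  "adj (cycle_graph k) i j \<longleftrightarrow>
    i < k \<and> j < k \<and> (j = i + 1 \<or> j = 0 \<and> i + 1 = k \<or> i = j + 1 \<or> i = 0 \<and> j + 1 = k)"
proof (cases "i < k \<and> j < k")
  case True
  then have ij: "i < k" "j < k" by auto
  show ?thesis
    unfolding adj_cycle_graph eq_Suc_mod_iff[OF ij] eq_Suc_mod_iff[OF ij(2,1)] using ij by blast
next
  case False
  then show ?thesis by (auto simp: adj_cycle_graph)
qed

lemma adj_torus:
  "adj (cycle_graph n \<box> cycle_graph m) (i, j) (i', j') \<longleftrightarrow>
    i < n \<and> j < m \<and> i' < n \<and> j' < m \<and>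
    (i = i' \<and> (j' = j + 1 \<or> j' = 0 \<and> j + 1 = m \<or> j = j' + 1 \<or> j = 0 \<and> j' + 1 = m) \<or>
     j = j' \<and> (i' = i + 1 \<or> i' = 0 \<and> i + 1 = n \<or> i = i' + 1 \<or> i = 0 \<and> i' + 1 = n))"
  by (simp add: adj_box_prod verts_torus adj_cycle_graph_iff) blast

lemma simple_graph_torus:
  "n \<ge> 3 \<Longrightarrow> m \<ge> 3 \<Longrightarrow> simple_graph (cycle_graph n \<box> cycle_graph m)"
  by (intro simple_graph_box_prod simple_graph_cycle_graph)

lemma forced_torus_step:
  assumes "(i, j) \<in> forced (cycle_graph n \<box> cycle_graph m) B"
    and "adj (cycle_graph n \<box> cycle_graph m) (i, j) w"
    and "\<And>i' j'. adj (cycle_graph n \<box> cycle_graph m) (i, j) (i', j') \<Longrightarrow> (i', j') \<noteq> w \<Longrightarrow>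
      (i', j') \<in> forced (cycle_graph n \<box> cycle_graph m) B"
  shows "w \<in> forced (cycle_graph n \<box> cycle_graph m) B"
proof (rule forced.step[OF assms(1)])
  show "w \<in> verts (cycle_graph n \<box> cycle_graph m)"
    using assms(2) by (cases w) (simp add: adj_torus verts_torus)
qed (use assms in auto)

text \<open>Once a column and its cyclic predecessor are blue, each vertex of the column has only
  its neighbour in the next column left and forces it. Columns \<open>m - 1\<close> and
  \<open>0\<close> start the sweep.\<close>

lemma forced_two_columns:
  fixes n m :: nat and B :: "(nat \<times> nat) set"
  defines "F \<equiv> forced (cycle_graph n \<box> cycle_graph m) B"
  assumes first: "\<And>i. i < n \<Longrightarrow> (i, 0) \<in> F" and last: "\<And>i. i < n \<Longrightarrow> (i, m - 1) \<in> F"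
  shows "verts (cycle_graph n \<box> cycle_graph m) \<subseteq> F"
proof -
  have "\<forall>i<n. (i, j) \<in> F" if "j < m" for j
    using that
  proof (induction j rule: less_induct)
    case (less j)
    show ?case
    proof (cases j)
      case 0
      then show ?thesis using first by simp
    next
      case (Suc k)
      show ?thesis
      proof (intro allI impI)
        fix i assume i: "i < n"
        have k: "(i', k) \<in> F" if "i' < n" for i' using less Suc that by auto
        \<comment> \<open>For \<open>k = 0\<close> the preceding column is \<open>m - 1\<close>,
          which is where \<open>last\<close> enters.\<close>
        have prev: "(i', j') \<in> F" if "j' + 1 = k \<or> k = 0 \<and> j' + 1 = m" "i' < n" for i' j'
          using that(1)
        proof
          assume "k = 0 \<and> j' + 1 = m"
          then have "j' = m - 1" by auto
          then show ?thesis using last that(2) by simp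
        qed (use less Suc that in auto)
        show "(i, j) \<in> F"
          unfolding F_def
        proof (rule forced_torus_step)
          show "(i, k) \<in> forced (cycle_graph n \<box> cycle_graph m) B"
            using k[OF i] by (simp add: F_def)
          show "adj (cycle_graph n \<box> cycle_graph m) (i, k) (i, j)"
            using i less.prems Suc by (simp add: adj_torus)
          fix i' j'
          assume "adj (cycle_graph n \<box> cycle_graph m) (i, k) (i', j')" "(i', j') \<noteq> (i, j)"
          then have "i' < n" "j' = k \<or> j' + 1 = k \<or> k = 0 \<and> j' + 1 = m"
            using less.prems Suc by (auto simp: adj_torus)
          then show "(i', j') \<in> forced (cycle_graph n \<box> cycle_graph m) B"
            using k prev unfolding F_def by blast
        qed
      qed
    qed
  qed
  then show ?thesis by (auto simp: verts_torus)
qed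

lemma zero_forcing_number_torus_le:
  assumes "n \<ge> 3" "m \<ge> 3"
  shows "zero_forcing_number (cycle_graph n \<box> cycle_graph m) \<le> 2 * n"
proof -
  let ?B = "{..<n} \<times> {0, m - 1}"
  have "zero_forcing_number (cycle_graph n \<box> cycle_graph m) \<le> card ?B"
  proof (rule zero_forcing_number_le)
    show "simple_graph (cycle_graph n \<box> cycle_graph m)" using assms by (rule simple_graph_torus)
    show "?B \<subseteq> verts (cycle_graph n \<box> cycle_graph m)" using assms by (auto simp: verts_torus)
    show "verts (cycle_graph n \<box> cycle_graph m) \<subseteq> forced (cycle_graph n \<box> cycle_graph m) ?B"
      by (rule forced_two_columns) (auto intro: forced.base)
  qed
  also have "card ?B = 2 * n" using assms by (simp add: card_cartesian_product card_insert_if)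
  finally show ?thesis .
qed

text \<open>In rows \<open>h + d\<close> and \<open>h - d\<close> the vertices at distance at least
  \<open>d\<close> from column \<open>h\<close> become blue. Since \<open>d \<le> h\<close>, columns
  \<open>0\<close> and \<open>2 * h\<close> are blue in every row, and they are adjacent because
  \<open>n = 2 * h + 1\<close>.\<close>

lemma zero_forcing_number_odd_torus_le:
  assumes "n \<ge> 3" "odd n"
  shows "zero_forcing_number (cycle_graph n \<box> cycle_graph n) \<le> 2 * n - 1"
proof -
  obtain h where n: "n = 2 * h + 1" using assms(2) by (auto elim: oddE)
  have h: "h \<ge> 1" using assms(1) n by simp
  let ?G = "cycle_graph n \<box> cycle_graph n"
  \<comment> \<open>A full row and the next row without the single vertex \<open>(h + 1, h)\<close>,
    the apex of the cone.\<close>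
  define B where "B = {h} \<times> {..<n} \<union> {h + 1} \<times> ({..<n} - {h})"
  define F where "F = forced ?G B"
  \<comment> \<open>Distance at least \<open>d\<close> from the middle column, written without
    truncated subtraction.\<close>
  define far where "far d j \<longleftrightarrow> j < n \<and> (j + d \<le> h \<or> h + d \<le> j)" for d j
  have step: "w \<in> F" if "(i, j) \<in> F" "adj ?G (i, j) w"
    "\<And>i' j'. adj ?G (i, j) (i', j') \<Longrightarrow> (i', j') \<noteq> w \<Longrightarrow> (i', j') \<in> F" for i j w
    using forced_torus_step[of i j n n B w] that unfolding F_def by blast
  have row: "(h, j) \<in> F" if "j < n" for j
    using that by (auto simp: F_def B_def intro: forced.base)
  have up1: "(h + 1, j) \<in> F" if "j < n" "j \<noteq> h" for j
    using that by (auto simp: F_def B_def intro: forced.base)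
  \<comment> \<open>A cyclic step changes the distance by at most one. Across the seam, columns
    \<open>0\<close> and \<open>n - 1\<close> both have distance \<open>h\<close>, which is where
    \<open>d \<le> h\<close> matters.\<close>
  have far_nbr: "far d j'" if "far (d + 1) j" "j' < n"
    "j' = j + 1 \<or> j' = 0 \<and> j + 1 = n \<or> j = j' + 1 \<or> j = 0 \<and> j' + 1 = n" "d \<le> h" for d j j'
    using that n by (auto simp: far_def)
  have up: "d \<le> h \<Longrightarrow> \<forall>j. far d j \<longrightarrow> (h + d, j) \<in> F" for d
  proof (induction d rule: less_induct)
    case (less d)
    \<comment> \<open>Row \<open>h + d\<close> is forced from the two rows before it, so two rows
      serve as base.\<close>
    consider "d = 0" | "d = 1" | e where "d = e + 2"
      by (cases d; cases "d - 1") auto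
    then show ?case
    proof cases
      case 3
      show ?thesis
      proof (intro allI impI)
        fix j assume j: "far d j"
        then have jn: "j < n" and je: "far e j" "far (e + 1) j" using 3 by (auto simp: far_def)
        have e0: "(h + e, j') \<in> F" if "far e j'" for j' using less 3 that by auto
        have e1: "(h + (e + 1), j') \<in> F" if "far (e + 1) j'" for j'
          using less.IH[of "e + 1"] less.prems 3 that by auto
        show "(h + d, j) \<in> F"
        proof (rule step)
          show "(h + (e + 1), j) \<in> F" using e1 je by simp
          show "adj ?G (h + (e + 1), j) (h + d, j)" using jn less.prems 3 n by (auto simp: adj_torus)
          fix i' j' assume "adj ?G (h + (e + 1), j) (i', j')" "(i', j') \<noteq> (h + d, j)"
          then consider "i' = h + e" "j' = j"
            | "i' = h + (e + 1)" "j' < n" "j' = j + 1 \<or> j' = 0 \<and> j + 1 = n \<or> j = j' + 1 \<or> j = 0 \<and> j' + 1 = n"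
            using less.prems 3 n by (auto simp: adj_torus)
          then show "(i', j') \<in> F"
          proof cases
            case 1 then show ?thesis using e0 je by simp
          next
            case 2
            then have "far (e + 1) j'" using far_nbr[of "e + 1" j j'] j 3 less.prems by simp
            then show ?thesis using e1 2 by simp
          qed
        qed
      qed
    qed (use row up1 in \<open>auto simp: far_def\<close>)
  qed
  have down: "d \<le> h \<Longrightarrow> \<forall>j. far d j \<longrightarrow> (h - d, j) \<in> F" for d
  proof (induction d rule: less_induct)
    case (less d)
    show ?case
    proof (cases d)
      case 0 then show ?thesis using row by (auto simp: far_def)
    next
      case (Suc e)
      show ?thesis
      proof (intro allI impI)
        fix j assume j: "far d j"
        then have jn: "j < n" and je: "far e j" using Suc by (auto simp: far_def)
        have e1: "(h - e, j') \<in> F" if "far e j'" for j' using less Suc that by auto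
        \<comment> \<open>The other vertical neighbour. For \<open>e = 0\<close> it lies in row
          \<open>h + 1\<close>, and \<open>far 1 j\<close> keeps it away from the missing vertex;
          otherwise the induction covers it.\<close>
        have e0: "(h - e + 1, j) \<in> F"
        proof (cases e)
          case 0
          then show ?thesis using up1 j Suc by (auto simp: far_def)
        next
          case (Suc e')
          then have "far e' j" "h - e + 1 = h - e'" using je less.prems \<open>d = Suc e\<close> by (auto simp: far_def)
          then show ?thesis using less Suc \<open>d = Suc e\<close> by auto
        qed
        show "(h - d, j) \<in> F"
        proof (rule step)
          show "(h - e, j) \<in> F" using e1 je by simp
          show "adj ?G (h - e, j) (h - d, j)" using jn less.prems Suc n by (auto simp: adj_torus)
          fix i' j' assume "adj ?G (h - e, j) (i', j')" "(i', j') \<noteq> (h - d, j)"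
          then consider "i' = h - e + 1" "j' = j"
            | "i' = h - e" "j' < n" "j' = j + 1 \<or> j' = 0 \<and> j + 1 = n \<or> j = j' + 1 \<or> j = 0 \<and> j' + 1 = n"
            using less.prems Suc n by (auto simp: adj_torus)
          then show "(i', j') \<in> F"
          proof cases
            case 1 then show ?thesis using e0 by simp
          next
            case 2
            then have "far e j'" using far_nbr[of e j j'] j Suc less.prems by simp
            then show ?thesis using e1 2 by simp
          qed
        qed
      qed
    qed
  qed
  have ends: "(i, j) \<in> F" if "i < n" "far h j" for i j
  proof (cases "i \<le> h")
    case True
    have "far (h - i) j" using that by (auto simp: far_def)
    then show ?thesis using down[of "h - i"] True by auto
  next
    case False
    have "far (i - h) j" using that False n by (auto simp: far_def)
    then show ?thesis using up[of "i - h"] False that n by auto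
  qed
  have "zero_forcing_number ?G \<le> card B"
  proof (rule zero_forcing_number_le)
    show "simple_graph ?G" using assms by (intro simple_graph_torus)
    show "B \<subseteq> verts ?G" using n h by (auto simp: verts_torus B_def)
    show "verts ?G \<subseteq> forced ?G B"
      using ends n unfolding F_def by (intro forced_two_columns) (auto simp: far_def)
  qed
  also have "card B = card ({h} \<times> {..<n}) + card ({h + 1} \<times> ({..<n} - {h}))"
    unfolding B_def by (intro card_Un_disjoint) auto
  also have "\<dots> = 2 * n - 1" using n by (simp add: card_cartesian_product)
  finally show ?thesis .
qed

section \<open>Interpolation and orthogonal polynomials\<close>

lemma degree_prod_linear: "degree (\<Prod>j\<in>J. [:- f j, 1:] :: 'a :: idom poly) = card J"
  by (subst degree_prod_eq_sum_degree) auto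

lemma lead_coeff_prod_linear: "lead_coeff (\<Prod>j\<in>J. [:- f j, 1:] :: 'a :: idom poly) = 1"
  by (simp add: lead_coeff_prod)

text \<open>Both sides have degree below \<open>r\<close> and agree at \<open>r\<close> distinct
  nodes: at \<open>x k\<close> only the \<open>k\<close>-th summand survives.\<close>

lemma Lagrange_interpolation:
  fixes q :: "'a :: field poly"
  assumes inj: "inj_on x {..<r}" and deg: "degree q < r"
  shows "q = (\<Sum>i<r. Polynomial.smult (poly q (x i) / (\<Prod>j\<in>{..<r} - {i}. x i - x j))
    (\<Prod>j\<in>{..<r} - {i}. [:- x j, 1:]))" (is "q = ?R")
proof (rule poly_eqI_degree[where A = "x ` {..<r}"])
  have card: "card (x ` {..<r}) = r" using card_image[OF inj] by simp
  show "degree q < card (x ` {..<r})" using deg card by simp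
  have "degree ?R < r"
    using deg by (intro degree_sum_less) (auto intro!: le_less_trans[OF degree_smult_le] simp: degree_prod_linear)
  then show "degree ?R < card (x ` {..<r})" using card by simp
  fix z assume "z \<in> x ` {..<r}"
  then obtain k where k: "k < r" "z = x k" by auto
  have "(\<Prod>j\<in>{..<r} - {i}. x k - x j) = 0" if "i < r" "i \<noteq> k" for i
    using that k by (auto simp: prod_zero_iff)
  then have "poly ?R z = (\<Sum>i\<in>{k}. poly q (x i) / (\<Prod>j\<in>{..<r} - {i}. x i - x j) *
      (\<Prod>j\<in>{..<r} - {i}. x k - x j))"
    unfolding poly_sum using k by (intro sum.mono_neutral_cong_right) (auto simp: poly_prod)
  moreover have "(\<Prod>j\<in>{..<r} - {k}. x k - x j) \<noteq> 0"
    using inj k by (auto simp: prod_zero_iff inj_on_def)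
  ultimately show "poly q z = poly ?R z" using k by simp
qed

text \<open>The sum is the coefficient of X^(r-1) on the right of the Lagrange formula, hence that
  of \<open>q\<close>, whose degree is too small.\<close>

lemma sum_poly_divide_prod_differences:
  fixes q :: "'a :: field poly"
  assumes inj: "inj_on x {..<r}" and deg: "degree q + 1 < r"
  shows "(\<Sum>i<r. poly q (x i) / (\<Prod>j\<in>{..<r} - {i}. x i - x j)) = 0"
proof -
  have "coeff (\<Prod>j\<in>{..<r} - {i}. [:- x j, 1:]) (r - 1) = 1" if "i < r" for i
  proof -
    have "degree (\<Prod>j\<in>{..<r} - {i}. [:- x j, 1:]) = r - 1"
      using that by (simp add: degree_prod_linear)
    then show ?thesis using lead_coeff_prod_linear[of x "{..<r} - {i}"] by simp
  qed
  then have "(\<Sum>i<r. poly q (x i) / (\<Prod>j\<in>{..<r} - {i}. x i - x j)) =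
    coeff (\<Sum>i<r. Polynomial.smult (poly q (x i) / (\<Prod>j\<in>{..<r} - {i}. x i - x j))
      (\<Prod>j\<in>{..<r} - {i}. [:- x j, 1:])) (r - 1)"
    by (simp add: coeff_sum)
  also have "\<dots> = coeff q (r - 1)"
    using Lagrange_interpolation[OF inj, of q] deg by simp
  also have "\<dots> = 0" using deg by (intro coeff_eq_0) simp
  finally show ?thesis .
qed

text \<open>Let \<open>H\<close> and \<open>M\<close> be monic with roots \<open>h k\<close> and
  \<open>x j\<close>. Division gives H = (X - a) M + Q with deg Q < L. At a root \<open>h k\<close>
  this reads Q / M = a - h k, and the sum is the partial fraction expansion of Q / M, because
  \<open>Q\<close> agrees with \<open>H\<close> at the \<open>x j\<close>.\<close>

lemma partial_fraction_at_roots: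
  fixes x h :: "nat \<Rightarrow> 'a :: field"
  assumes inj: "inj_on x {..<L}" and L: "L \<ge> 1"
  obtains a where "\<And>k. k \<le> L \<Longrightarrow> h k \<notin> x ` {..<L} \<Longrightarrow>
    (\<Sum>j<L. (\<Prod>l<L + 1. x j - h l) / (\<Prod>l\<in>{..<L} - {j}. x j - x l) / (h k - x j)) = a - h k"
proof -
  define H where "H = (\<Prod>l<L + 1. [:- h l, 1:])"
  define M where "M = (\<Prod>j<L. [:- x j, 1:])"
  have dH: "degree H = L + 1" "coeff H (L + 1) = 1"
    using degree_prod_linear[of h "{..<L + 1}"] lead_coeff_prod_linear[of h "{..<L + 1}"]
    by (simp_all add: H_def)
  have dM: "degree M = L" "coeff M L = 1"
    using degree_prod_linear[of x "{..<L}"] lead_coeff_prod_linear[of x "{..<L}"]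
    by (simp_all add: M_def)
  \<comment> \<open>Chosen to make the coefficient of X^L in \<open>Q\<close> vanish.\<close>
  define a where "a = coeff M (L - 1) - coeff H L"
  define Q where "Q = H - [:- a, 1:] * M"
  obtain L' where L': "L = Suc L'" using L by (cases L) auto
  have "coeff Q i = 0" if "i \<ge> L" for i
  proof -
    have "i = L \<or> i = L + 1 \<or> i > L + 1" using that by auto
    then show ?thesis
      using dH dM L' by (auto simp: Q_def a_def coeff_eq_0 coeff_pCons split: nat.splits)
  qed
  then have degQ: "degree Q < L" using L by (intro degree_lessI) auto
  have Mx: "poly M (x j) = 0" if "j < L" for j
    using that by (auto simp: M_def poly_prod prod_zero_iff)
  show ?thesis
  proof
    fix k assume k: "k \<le> L" "h k \<notin> x ` {..<L}"
    have M0: "poly M (h k) \<noteq> 0" using k by (auto simp: M_def poly_prod prod_zero_iff)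
    have H0: "poly H (h k) = 0"
      unfolding H_def poly_prod using k(1) by (intro prod_zero) (auto intro!: bexI[of _ k])
    have "poly M (h k) * (a - h k) = poly Q (h k)"
      by (simp add: Q_def H0 algebra_simps)
    also have "\<dots> = (\<Sum>j<L. poly Q (x j) / (\<Prod>l\<in>{..<L} - {j}. x j - x l) *
      (\<Prod>l\<in>{..<L} - {j}. h k - x l))"
      by (subst Lagrange_interpolation[OF inj degQ]) (simp add: poly_sum poly_prod)
    also have "\<dots> = (\<Sum>j<L. poly M (h k) *
      ((\<Prod>l<L + 1. x j - h l) / (\<Prod>l\<in>{..<L} - {j}. x j - x l) / (h k - x j)))"
    proof (intro sum.cong refl)
      fix j assume "j \<in> {..<L}"
      then have j: "j < L" by simp
      have "poly M (h k) = (h k - x j) * (\<Prod>l\<in>{..<L} - {j}. h k - x l)"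
        using j by (simp add: M_def poly_prod prod.remove[of "{..<L}" j] algebra_simps)
      moreover have "h k - x j \<noteq> 0" using k j by auto
      moreover have "poly Q (x j) = (\<Prod>l<L + 1. x j - h l)"
        by (simp add: Q_def Mx[OF j] H_def poly_prod del: prod.lessThan_Suc)
      ultimately show "poly Q (x j) / (\<Prod>l\<in>{..<L} - {j}. x j - x l) * (\<Prod>l\<in>{..<L} - {j}. h k - x l) =
        poly M (h k) * ((\<Prod>l<L + 1. x j - h l) / (\<Prod>l\<in>{..<L} - {j}. x j - x l) / (h k - x j))"
        by simp
    qed
    also have "\<dots> = poly M (h k) *
      (\<Sum>j<L. (\<Prod>l<L + 1. x j - h l) / (\<Prod>l\<in>{..<L} - {j}. x j - x l) / (h k - x j))"
      by (simp add: sum_distrib_left)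
    finally show "(\<Sum>j<L. (\<Prod>l<L + 1. x j - h l) / (\<Prod>l\<in>{..<L} - {j}. x j - x l) / (h k - x j)) = a - h k"
      using M0 by simp
  qed
qed

text \<open>A nonzero polynomial of degree below \<open>r\<close> cannot vanish at all
  \<open>r\<close> nodes, so the weighted form is positive definite on such polynomials.\<close>

lemma sum_weighted_poly_square_pos:
  fixes p :: "real poly"
  assumes inj: "inj_on x {..<r}" and w: "\<And>i. i < r \<Longrightarrow> w i > 0" and p: "p \<noteq> 0" "degree p < r"
  shows "(\<Sum>i<r. w i * poly p (x i) * poly p (x i)) > 0"
proof -
  have "\<exists>i<r. poly p (x i) \<noteq> 0"
  proof (rule ccontr)
    assume "\<not> ?thesis"
    then have "p = 0"
      using p card_image[OF inj] by (intro poly_eqI_degree[of "x ` {..<r}"]) auto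
    with p show False by simp
  qed
  then obtain i where i: "i < r" "poly p (x i) \<noteq> 0" by auto
  have nonneg: "0 \<le> w k * poly p (x k) * poly p (x k)" if "k \<in> {..<r}" for k
    using w[of k] that by (simp add: mult.assoc)
  have "0 < w i * poly p (x i) * poly p (x i)"
    using w[OF i(1)] i(2) by (simp add: mult.assoc zero_less_mult_iff) (meson linorder_neqE_linordered_idom)
  then show ?thesis
    using i(1) nonneg by (intro sum_pos2[of _ i]) auto
qed

text \<open>Gram-Schmidt applied to the monomials.\<close>

lemma monic_orthogonal_poly_exists:
  fixes x w :: "nat \<Rightarrow> real"
  assumes inj: "inj_on x {..<r}" and w: "\<And>i. i < r \<Longrightarrow> w i > 0" and "k < r"
  shows "\<exists>p. degree p = k \<and> coeff p k = 1 \<and>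
    (\<forall>q. degree q < k \<longrightarrow> (\<Sum>i<r. w i * poly q (x i) * poly p (x i)) = 0)"
  using \<open>k < r\<close>
proof (induction k rule: less_induct)
  case (less k)
  define ip where "ip p q = (\<Sum>i<r. w i * poly p (x i) * poly q (x i))" for p q
  have ip_add: "ip (p + q) s = ip p s + ip q s" "ip (Polynomial.smult c p) s = c * ip p s"
    "ip s (p - q) = ip s p - ip s q" "ip s (Polynomial.smult c p) = c * ip s p" "ip p q = ip q p" for p q s c
    by (simp_all add: ip_def algebra_simps sum.distrib sum_subtractf sum_distrib_left)
  have ip_sum: "ip s (\<Sum>l\<in>B. f l) = (\<Sum>l\<in>B. ip s (f l))" for s f and B :: "nat set"
    unfolding ip_def poly_sum sum_distrib_left by (rule sum.swap)
  have "\<forall>l\<in>{..<k}. \<exists>p. degree p = l \<and> coeff p l = 1 \<and> (\<forall>q. degree q < l \<longrightarrow> ip q p = 0)"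
    using less unfolding ip_def by auto
  then obtain P where P: "\<And>l. l < k \<Longrightarrow> degree (P l) = l" "\<And>l. l < k \<Longrightarrow> coeff (P l) l = 1"
    "\<And>l q. l < k \<Longrightarrow> degree q < l \<Longrightarrow> ip q (P l) = 0"
    unfolding bchoice_iff by auto
  have pos: "ip (P l) (P l) > 0" if "l < k" for l
    unfolding ip_def using P(1,2)[OF that] that less.prems
    by (intro sum_weighted_poly_square_pos[OF inj w]) auto
  have orth: "ip (P l) (P l') = 0" if "l < k" "l' < k" "l \<noteq> l'" for l l'
    using P(1,3) that ip_add(5)[of "P l" "P l'"] by (metis linorder_neqE_nat)
  \<comment> \<open>The orthogonal projection of X^k onto the span of the earlier
    polynomials.\<close>
  define R where "R = (\<Sum>l<k. Polynomial.smult (ip (P l) (monom 1 k) / ip (P l) (P l)) (P l))"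
  define p where "p = monom 1 k - R"
  have degR: "degree R < k \<or> R = 0"
  proof (cases "k = 0")
    case False
    then show ?thesis unfolding R_def
      by (intro disjI1 degree_sum_less) (auto intro!: le_less_trans[OF degree_smult_le] simp: P(1))
  qed (simp add: R_def)
  then have "coeff R i = 0" if "i \<ge> k" for i using that by (auto intro: coeff_eq_0)
  then have cp: "coeff p i = (if i = k then 1 else 0)" if "i \<ge> k" for i using that by (simp add: p_def)
  then have degp: "degree p = k"
    by (intro antisym degree_le le_degree) auto
  have pP: "ip (P l) p = 0" if l: "l < k" for l
  proof -
    have "ip (P l) R = (\<Sum>l'\<in>{l}. ip (P l) (Polynomial.smult (ip (P l') (monom 1 k) / ip (P l') (P l')) (P l')))"
      unfolding R_def ip_sum using l orth
      by (intro sum.mono_neutral_right) (auto simp: ip_add(4))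
    then show ?thesis using pos[OF l] by (simp add: p_def ip_add(3,4))
  qed
  \<comment> \<open>Orthogonality passes from the \<open>P l\<close> to every \<open>q\<close> of
    lower degree by subtracting the leading term of \<open>q\<close> as a multiple of
    \<open>P d\<close>.\<close>
  have "ip q p = 0" if "degree q < k" for q
    using that
  proof (induction "degree q" arbitrary: q rule: less_induct)
    case less
    define d where "d = degree q"
    have dk: "d < k" using less.prems d_def by simp
    define q' where "q' = q - Polynomial.smult (coeff q d) (P d)"
    have ipq: "ip q p = ip q' p"
      using ip_add(1)[of q' "Polynomial.smult (coeff q d) (P d)" p] ip_add(2)[of "coeff q d" "P d" p] pP[OF dk]
      by (simp add: q'_def)
    have coeffs: "coeff q' i = 0" if "i \<ge> d" for i
    proof (cases "i = d")
      case False
      then show ?thesis using that P(1)[OF dk] by (simp add: q'_def coeff_eq_0 d_def)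
    qed (simp add: q'_def P(2)[OF dk])
    show ?case
    proof (cases "q' = 0")
      case True
      then show ?thesis using ipq by (simp add: ip_def)
    next
      case False
      then have "degree q' < d" using coeffs by (intro degree_lessI) auto
      then show ?thesis using less.hyps[of q'] ipq dk d_def by simp
    qed
  qed
  then show ?case using degp cp[of k] unfolding ip_def by auto
qed

text \<open>A square matrix with orthonormal rows has orthonormal columns.\<close>

lemma orthonormal_complete:
  fixes t :: "nat \<Rightarrow> nat \<Rightarrow> real"
  assumes on: "\<And>k l. k < r \<Longrightarrow> l < r \<Longrightarrow> (\<Sum>i<r. t k i * t l i) = (if k = l then 1 else 0)"
    and ij: "i < r" "j < r"
  shows "(\<Sum>k<r. t k i * t k j) = (if i = j then 1 else 0)"
proof -
  define T where "T = mat r r (\<lambda>(k, i). t k i)"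
  have T: "T \<in> carrier_mat r r" "T\<^sup>T \<in> carrier_mat r r" by (simp_all add: T_def)
  have "T * T\<^sup>T = 1\<^sub>m r"
    by (rule eq_matI) (simp_all add: T_def scalar_prod_def atLeast0LessThan on)
  then have "T\<^sup>T * T = 1\<^sub>m r" by (rule mat_mult_left_right_inverse[OF T])
  then have "(T\<^sup>T * T) $$ (i, j) = 1\<^sub>m r $$ (i, j)" by simp
  then show ?thesis using ij by (simp add: T_def scalar_prod_def atLeast0LessThan)
qed

text \<open>
  The weights \<open>1 / \<bar>D i\<bar>\<close> are those for which the last orthogonal polynomial takes the values
  \<open>\<plusminus> const\<close> at the nodes: by Lagrange interpolation the vector of signs of \<open>D\<close> is orthogonal to all
  polynomials of lower degree.
\<close>

lemma Jacobi_basis_exists: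
  fixes x :: "nat \<Rightarrow> real"
  assumes inj: "inj_on x {..<r}" and r: "r \<ge> 2"
  defines "D \<equiv> \<lambda>i. \<Prod>j\<in>{..<r} - {i}. x i - x j"
  defines "w \<equiv> \<lambda>i. 1 / \<bar>D i\<bar>"
  obtains t c0 c1 where
    "\<And>k l. k < r \<Longrightarrow> l < r \<Longrightarrow> (\<Sum>i<r. t k i * t l i) = (if k = l then 1 else 0)"
    "\<And>k l. k + 1 < l \<Longrightarrow> l < r \<Longrightarrow> (\<Sum>i<r. x i * t k i * t l i) = 0"
    "\<And>k. k + 1 < r \<Longrightarrow> (\<Sum>i<r. x i * t k i * t (k + 1) i) \<noteq> 0"
    "\<And>i. i < r \<Longrightarrow> sqrt (w i) = c0 * t 0 i"
    "\<And>i. i < r \<Longrightarrow> sgn (D i) * sqrt (w i) = c1 * t (r - 1) i"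
    "c0 \<noteq> 0" "c1 \<noteq> 0"
proof -
  define ip where "ip p q = (\<Sum>i<r. w i * poly p (x i) * poly q (x i))" for p q
  have D0: "D i \<noteq> 0" if "i < r" for i
    using inj that by (auto simp: D_def prod_zero_iff inj_on_def)
  then have w: "w i > 0" if "i < r" for i using that by (simp add: w_def)
  have "\<forall>k\<in>{..<r}. \<exists>p. degree p = k \<and> coeff p k = 1 \<and> (\<forall>q. degree q < k \<longrightarrow> ip q p = 0)"
    using monic_orthogonal_poly_exists[OF inj w] unfolding ip_def by auto
  then obtain P where P: "\<And>k. k < r \<Longrightarrow> degree (P k) = k" "\<And>k. k < r \<Longrightarrow> coeff (P k) k = 1"
    "\<And>k q. k < r \<Longrightarrow> degree q < k \<Longrightarrow> ip q (P k) = 0"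
    unfolding bchoice_iff by auto
  have ip_sym: "ip p q = ip q p" for p q by (simp add: ip_def mult_ac)
  have pos: "ip (P k) (P k) > 0" if "k < r" for k
    unfolding ip_def using P(1,2)[OF that] that
    by (intro sum_weighted_poly_square_pos[OF inj w]) auto
  have orth: "ip (P k) (P l) = 0" if "k < r" "l < r" "k \<noteq> l" for k l
    using P(1,3) that ip_sym[of "P k" "P l"] by (metis linorder_neqE_nat)
  define n where "n k = sqrt (ip (P k) (P k))" for k
  have n: "n k > 0" if "k < r" for k using pos[OF that] by (simp add: n_def)
  \<comment> \<open>The factor \<open>sqrt (w i)\<close> turns the weighted form \<open>ip\<close>
    into the standard inner product, so orthonormal polynomials become orthonormal vectors.\<close>
  define t where "t k i = sqrt (w i) * poly (P k) (x i) / n k" for k i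
  have sum_t: "(\<Sum>i<r. f i * t k i * t l i) = (\<Sum>i<r. w i * (f i * poly (P k) (x i)) * poly (P l) (x i)) / (n k * n l)"
    for k l and f :: "nat \<Rightarrow> real"
    unfolding sum_divide_distrib
  proof (intro sum.cong refl)
    fix i assume "i \<in> {..<r}"
    then have "sqrt (w i) * sqrt (w i) = w i" using w[of i] by simp
    then have "f i * t k i * t l i = (sqrt (w i) * sqrt (w i)) * (f i * poly (P k) (x i)) * poly (P l) (x i) / (n k * n l)"
      by (simp only: t_def) (simp add: field_simps)
    then show "f i * t k i * t l i = w i * (f i * poly (P k) (x i)) * poly (P l) (x i) / (n k * n l)"
      using \<open>sqrt (w i) * sqrt (w i) = w i\<close> by simp
  qed
  have on: "(\<Sum>i<r. t k i * t l i) = (if k = l then 1 else 0)" if "k < r" "l < r" for k l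
  proof -
    have "(\<Sum>i<r. t k i * t l i) = ip (P k) (P l) / (n k * n l)"
      using sum_t[of "\<lambda>_. 1" k l] by (simp add: ip_def)
    then show ?thesis using orth[OF that] pos[OF that(1)] by (cases "k = l") (simp_all add: n_def)
  qed
  have xt: "(\<Sum>i<r. x i * t k i * t l i) = ip ([:0, 1:] * P k) (P l) / (n k * n l)" for k l
    using sum_t[of x k l] by (simp add: ip_def)
  show thesis
  proof
    show "(\<Sum>i<r. t k i * t l i) = (if k = l then 1 else 0)" if "k < r" "l < r" for k l
      using on that .
    show "(\<Sum>i<r. x i * t k i * t l i) = 0" if "k + 1 < l" "l < r" for k l
    proof -
      have "degree ([:0, 1:] * P k) \<le> k + 1"
        using degree_mult_le[of "[:0, 1:]" "P k"] P(1)[of k] that by simp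
      then show ?thesis using P(3)[of l] that xt[of k l] by simp
    qed
    show "(\<Sum>i<r. x i * t k i * t (k + 1) i) \<noteq> 0" if k: "k + 1 < r" for k
    proof -
      \<comment> \<open>The leading terms cancel, so \<open>q\<close> is orthogonal to
        \<open>P (k + 1)\<close> and the off-diagonal entry is a positive multiple of the squared
        norm of \<open>P (k + 1)\<close>.\<close>
      define q where "q = [:0, 1:] * P k - P (k + 1)"
      have "coeff q i = 0" if "i \<ge> k + 1" for i
        using that k P(1,2)[of k] P(1,2)[of "k + 1"]
        by (cases "i = k + 1") (auto simp: q_def coeff_eq_0 coeff_pCons split: nat.splits)
      then have "degree q < k + 1" by (intro degree_lessI) auto
      then have "ip q (P (k + 1)) = 0" using P(3) k by blast
      moreover have "ip ([:0, 1:] * P k) (P (k + 1)) = ip q (P (k + 1)) + ip (P (k + 1)) (P (k + 1))"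
        by (simp add: ip_def q_def sum.distrib[symmetric] algebra_simps)
      ultimately show ?thesis using xt[of k "k + 1"] pos[OF k] n[OF k] n[of k] k by simp
    qed
    have "degree (P 0) = 0" "coeff (P 0) 0 = 1" using P(1,2)[of 0] r by auto
    then have P0: "P 0 = 1" by (metis degree_0_id of_nat_1 one_pCons pCons_one)
    show "sqrt (w i) = n 0 * t 0 i" if "i < r" for i
      using n[of 0] r by (simp add: t_def P0)
    show "n 0 \<noteq> 0" using n[of 0] r by simp
    \<comment> \<open>The last coordinate of the signed weight vector in the basis \<open>t\<close>;
      all other coordinates vanish, as \<open>sgn (D j) * w j = 1 / D j\<close> makes them sums of
      Lagrange type.\<close>
    define c1 where "c1 = (\<Sum>j<r. sgn (D j) * sqrt (w j) * t (r - 1) j)"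
    show last: "sgn (D i) * sqrt (w i) = c1 * t (r - 1) i" if i: "i < r" for i
    proof -
      let ?v = "\<lambda>j. sgn (D j) * sqrt (w j)"
      have zero: "(\<Sum>j<r. ?v j * t k j) = 0" if k: "k + 1 < r" for k
      proof -
        have "(\<Sum>j<r. ?v j * t k j) = (\<Sum>j<r. poly (P k) (x j) / D j) / n k"
          unfolding sum_divide_distrib
        proof (intro sum.cong refl)
          fix j assume "j \<in> {..<r}"
          then have "w j = sqrt (w j) * sqrt (w j)" using w[of j] by simp
          moreover have "sgn (D j) * w j = 1 / D j" by (simp add: w_def sgn_if)
          moreover have "?v j * t k j = (sgn (D j) * (sqrt (w j) * sqrt (w j))) * poly (P k) (x j) / n k"
            by (simp only: t_def) (simp add: field_simps)
          ultimately show "?v j * t k j = poly (P k) (x j) / D j / n k"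
            by (metis divide_divide_eq_left mult.commute mult_1 times_divide_eq_left)
        qed
        also have "(\<Sum>j<r. poly (P k) (x j) / D j) = 0"
          unfolding D_def using P(1)[of k] k
          by (intro sum_poly_divide_prod_differences[OF inj]) simp
        finally show ?thesis by simp
      qed
      have "?v i = (\<Sum>j<r. ?v j * (if j = i then 1 else 0))" using i by (simp add: if_distrib[of "\<lambda>z. _ * z"] cong: if_cong)
      also have "\<dots> = (\<Sum>j<r. ?v j * (\<Sum>k<r. t k j * t k i))"
        using orthonormal_complete[OF on _ i] by (intro sum.cong) auto
      also have "\<dots> = (\<Sum>k<r. (\<Sum>j<r. ?v j * t k j) * t k i)"
        unfolding sum_distrib_left sum_distrib_right by (subst sum.swap) (simp add: mult_ac)
      also have "\<dots> = (\<Sum>k\<in>{r - 1}. (\<Sum>j<r. ?v j * t k j) * t k i)"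
        using zero r by (intro sum.mono_neutral_right) auto
      finally show ?thesis by (simp add: c1_def)
    qed
    show "c1 \<noteq> 0" using last[of 0] D0[of 0] w[of 0] r by (auto simp: sgn_if split: if_splits)
  qed
qed

text \<open>The factors with \<open>j < i\<close> are positive; the \<open>r - 1 - i\<close> factors
  with \<open>j > i\<close> are negative.\<close>

lemma sgn_prod_differences:
  fixes x :: "nat \<Rightarrow> real"
  assumes mono: "\<And>i j. i < j \<Longrightarrow> j < r \<Longrightarrow> x i < x j" and i: "i < r"
  shows "sgn (\<Prod>j\<in>{..<r} - {i}. x i - x j) = (- 1) ^ (r - 1 - i)"
proof -
  have sgn_prod: "sgn (\<Prod>j\<in>A. f j) = (\<Prod>j\<in>A. sgn (f j))" for A :: "nat set" and f :: "nat \<Rightarrow> real"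
    by (induction A rule: infinite_finite_induct) (auto simp: sgn_mult)
  have split: "{..<r} - {i} = {..<i} \<union> {i<..<r}" using i by auto
  have "sgn (\<Prod>j\<in>{..<r} - {i}. x i - x j) = (\<Prod>j<i. sgn (x i - x j)) * (\<Prod>j\<in>{i<..<r}. sgn (x i - x j))"
    unfolding sgn_prod split by (rule prod.union_disjoint) auto
  also have "(\<Prod>j<i. sgn (x i - x j)) = (\<Prod>j<i. 1)" using mono i by (intro prod.cong) auto
  also have "(\<Prod>j\<in>{i<..<r}. sgn (x i - x j)) = (\<Prod>j\<in>{i<..<r}. - 1)" using mono by (intro prod.cong) auto
  finally show ?thesis by simp
qed

text \<open>Splits the indices by parity. It separates the integer nodes from the others in the
  derivative of the node polynomial at an odd-indexed node.\<close>

lemma prod_interlaced: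
  fixes x :: "nat \<Rightarrow> 'a :: comm_ring_1"
  assumes "\<And>l. 2 * l < R \<Longrightarrow> x (2 * l) = y l" and "\<And>l. 2 * l + 1 < R \<Longrightarrow> x (2 * l + 1) = z l"
  shows "(\<Prod>k\<in>{..<R} - {2 * j + 1}. c - x k) =
    (\<Prod>l<(R + 1) div 2. c - y l) * (\<Prod>l\<in>{..<R div 2} - {j}. c - z l)"
proof -
  let ?E = "(\<lambda>l. 2 * l) ` {..<(R + 1) div 2}" and ?O = "(\<lambda>l. 2 * l + 1) ` ({..<R div 2} - {j})"
  have "k \<in> ?E \<union> ?O" if "k < R" "k \<noteq> 2 * j + 1" for k
  proof (cases "even k")
    case True
    then have "k = 2 * (k div 2)" "k div 2 < (R + 1) div 2" using that by auto
    then show ?thesis by blast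
  next
    case False
    then have "k = 2 * (k div 2) + 1" "k div 2 < R div 2" using that by presburger+
    moreover from this have "k div 2 \<noteq> j" using that(2) by auto
    ultimately show ?thesis by blast
  qed
  moreover have "?E \<union> ?O \<subseteq> {..<R} - {2 * j + 1}" by auto presburger
  ultimately have split: "{..<R} - {2 * j + 1} = ?E \<union> ?O" by blast
  have disj: "?E \<inter> ?O = {}" by auto presburger
  have "(\<Prod>k\<in>{..<R} - {2 * j + 1}. c - x k) = (\<Prod>k\<in>?E. c - x k) * (\<Prod>k\<in>?O. c - x k)"
    unfolding split by (rule prod.union_disjoint[OF _ _ disj]) simp_all
  also have "(\<Prod>k\<in>?E. c - x k) = (\<Prod>l<(R + 1) div 2. c - y l)"
    using assms(1) by (subst prod.reindex) (auto simp: inj_on_def intro!: prod.cong)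
  also have "(\<Prod>k\<in>?O. c - x k) = (\<Prod>l\<in>{..<R div 2} - {j}. c - z l)"
    using assms(2) by (subst prod.reindex) (auto simp: inj_on_def intro!: prod.cong)
  finally show ?thesis .
qed

section \<open>A cycle matrix with prescribed double eigenvalues\<close>

text \<open>
  The nodes are \<open>0 < \<mu>\<^sub>0 < 1 < \<mu>\<^sub>1 < \<dots>\<close>, where every \<open>\<mu>\<^sub>j\<close> is chosen by the intermediate value
  theorem such that a fixed product of linear factors \<open>x - l\<close> has the same absolute value \<open>c\<close> at all
  \<open>\<mu>\<^sub>j\<close>. This makes the residues of the partial fraction expansion proportional to the weights.
\<close>

lemma interlacing_nodes_exist:
  assumes r: "r \<ge> 2"
  obtains x :: "nat \<Rightarrow> real" and c a where
    "\<And>i j. i < j \<Longrightarrow> j < r \<Longrightarrow> x i < x j"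
    "\<And>l. 2 * l < r \<Longrightarrow> x (2 * l) = real l"
    "\<And>i l. i < r \<Longrightarrow> odd i \<Longrightarrow> x i \<noteq> real l"
    "c > 0"
    "\<And>k. 2 * k \<le> r \<Longrightarrow> (\<Sum>j<r div 2. c / \<bar>\<Prod>l\<in>{..<r} - {2 * j + 1}. x (2 * j + 1) - x l\<bar> /
      (real k - x (2 * j + 1))) = real k - a"
proof -
  define L where "L = r div 2"
  have L: "L \<ge> 1" using r by (simp add: L_def)
  \<comment> \<open>The roots 0, ..., L of \<open>H\<close> are the distinct eigenvalues wanted for
    the cycle on \<open>r + 1\<close> vertices; those of \<open>E\<close> are the even-indexed nodes
    below \<open>r\<close>.\<close>
  define H where "H y = (\<Prod>l<L + 1. y - real l)" for y
  define E where "E y = (\<Prod>l<(r + 1) div 2. y - real l)" for y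
  \<comment> \<open>Positive, and attained between \<open>j\<close> and \<open>j + 1/2\<close> for
    every \<open>j < L\<close>, because \<open>H\<close> vanishes at \<open>j\<close>.\<close>
  define c where "c = Min ((\<lambda>j. \<bar>H (real j + 1/2) * E (real j + 1/2)\<bar>) ` {..<L})"
  have half: "real j + 1/2 \<noteq> real l" for j l :: nat
  proof
    assume "real j + 1/2 = real l"
    then have "real (2 * j + 1) = real (2 * l)" by simp
    then have "2 * j + 1 = 2 * l" by (simp only: of_nat_eq_iff)
    then show False by presburger
  qed
  have c: "c > 0" unfolding c_def using L half
    by (subst Min_gr_iff) (auto simp: H_def E_def prod_zero_iff lessThan_empty_iff simp del: prod.lessThan_Suc)
  have "\<exists>y. real j < y \<and> y < real j + 1 \<and> \<bar>H y * E y\<bar> = c" if j: "j < L" for j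
  proof -
    have H0: "H (real j) = 0" unfolding H_def using j by (intro prod_zero) (auto intro!: bexI[of _ j])
    have "\<exists>y\<ge>real j. y \<le> real j + 1/2 \<and> \<bar>H y * E y\<bar> = c"
    proof (rule IVT')
      show "\<bar>H (real j) * E (real j)\<bar> \<le> c" using H0 c by simp
      show "c \<le> \<bar>H (real j + 1/2) * E (real j + 1/2)\<bar>"
        unfolding c_def using j by (intro Min_le) auto
      show "continuous_on {real j..real j + 1/2} (\<lambda>y. \<bar>H y * E y\<bar>)"
        unfolding H_def E_def by (intro continuous_intros)
    qed simp
    then obtain y where y: "y \<ge> real j" "y \<le> real j + 1/2" "\<bar>H y * E y\<bar> = c" by blast
    have "y \<noteq> real j" using y(3) H0 c by auto
    with y show ?thesis by (intro exI[of _ y]) auto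
  qed
  then obtain m where m: "\<And>j. j < L \<Longrightarrow> real j < m j" "\<And>j. j < L \<Longrightarrow> m j < real j + 1"
    "\<And>j. j < L \<Longrightarrow> \<bar>H (m j) * E (m j)\<bar> = c" by metis
  define x where "x i = (if even i then real (i div 2) else m (i div 2))" for i
  have xe: "x (2 * l) = real l" and xo: "x (2 * l + 1) = m l" for l by (simp_all add: x_def)
  have mono: "x i < x j" if "i < j" "j < 2 * L + 1" for i j
  proof -
    have bd: "real (k div 2) \<le> x k" "x k < real (k div 2) + 1" if "k < 2 * L + 1" for k
    proof -
      have "odd k \<Longrightarrow> k div 2 < L" using that by presburger
      then show "real (k div 2) \<le> x k" "x k < real (k div 2) + 1"
        using m(1,2)[of "k div 2"] by (auto simp: x_def)
    qed
    show ?thesis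
    proof (cases "i div 2 = j div 2")
      case True
      then have "even i" "odd j" using that by presburger+
      moreover have "j div 2 < L" using \<open>odd j\<close> that by presburger
      ultimately show ?thesis using m(1) True by (simp add: x_def)
    next
      case False
      then have "i div 2 + 1 \<le> j div 2" using that div_le_mono[of i j 2] by simp
      then have "real (i div 2) + 1 \<le> real (j div 2)" by linarith
      then show ?thesis using bd(2)[of i] bd(1)[of j] that by linarith
    qed
  qed
  have m_inj: "inj_on m {..<L}"
  proof (rule inj_onI)
    fix i j assume "i \<in> {..<L}" "j \<in> {..<L}" "m i = m j"
    then show "i = j" using m(1,2)[of i] m(1,2)[of j] by auto
  qed
  have m_nat: "m j \<noteq> real l" if "j < L" for j l using m(1,2)[OF that] by auto
  define M where "M j = (\<Prod>l\<in>{..<L} - {j}. m j - m l)" for j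
  obtain a where a: "\<And>k. k \<le> L \<Longrightarrow> real k \<notin> m ` {..<L} \<Longrightarrow>
    (\<Sum>j<L. (\<Prod>l<L + 1. m j - real l) / (\<Prod>l\<in>{..<L} - {j}. m j - m l) / (real k - m j)) = a - real k"
    using partial_fraction_at_roots[OF m_inj L, of real] by blast
  have weight: "c / \<bar>\<Prod>l\<in>{..<r} - {2 * j + 1}. x (2 * j + 1) - x l\<bar> = - (H (m j) / M j)" if j: "j < L" for j
  proof -
    have "(\<Prod>k\<in>{..<r} - {2 * j + 1}. x (2 * j + 1) - x k) = E (m j) * M j"
      using prod_interlaced[of r x real m "m j" j] xe xo by (simp add: E_def M_def L_def)
    \<comment> \<open>The sign of \<open>H (m j) * M j\<close> is read off from the
      \<open>2 * L + 1\<close> increasing points 0, \<open>m 0\<close>, 1, ..., L, whatever the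
      parity of \<open>r\<close>.\<close>
    moreover have "(\<Prod>k\<in>{..<2 * L + 1} - {2 * j + 1}. x (2 * j + 1) - x k) = H (m j) * M j"
      using prod_interlaced[of "2 * L + 1" x real m "m j" j] xe xo
      by (simp add: H_def M_def del: prod.lessThan_Suc)
    moreover have "sgn (\<Prod>k\<in>{..<2 * L + 1} - {2 * j + 1}. x (2 * j + 1) - x k) = - 1"
    proof -
      have "2 * L + 1 - 1 - (2 * j + 1) = 2 * (L - j - 1) + 1" using j by simp
      then show ?thesis using sgn_prod_differences[of "2 * L + 1" x "2 * j + 1"] mono j
        by (simp del: One_nat_def)
    qed
    ultimately have D: "(\<Prod>k\<in>{..<r} - {2 * j + 1}. x (2 * j + 1) - x k) = E (m j) * M j"
      and "sgn (H (m j) * M j) = - 1" by simp_all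
    then have neg: "H (m j) * M j < 0" by (simp only: sgn_1_neg)
    have "E (m j) \<noteq> 0" using m(3)[OF j] c by auto
    then have "c / \<bar>E (m j) * M j\<bar> = \<bar>H (m j) / M j\<bar>"
      using m(3)[OF j, symmetric] by (simp add: abs_mult abs_divide)
    also have "\<dots> = - (H (m j) / M j)"
      using neg by (auto simp: mult_less_0_iff abs_if divide_less_0_iff)
    finally show ?thesis using D by simp
  qed
  show thesis
  proof
    show "x i < x j" if "i < j" "j < r" for i j
      using mono[of i j] that by (simp add: L_def)
    show "x (2 * l) = real l" if "2 * l < r" for l by (rule xe)
    show "x i \<noteq> real l" if "i < r" "odd i" for i l
    proof -
      have "i div 2 < L" using that unfolding L_def by presburger
      then show ?thesis using m_nat that by (simp add: x_def)
    qed
    show "c > 0" by (rule c)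
    show "(\<Sum>j<r div 2. c / \<bar>\<Prod>l\<in>{..<r} - {2 * j + 1}. x (2 * j + 1) - x l\<bar> /
      (real k - x (2 * j + 1))) = real k - a" if "2 * k \<le> r" for k
    proof -
      have k: "k \<le> L" using that by (simp add: L_def)
      have k': "real k \<notin> m ` {..<L}" using m_nat by (metis imageE lessThan_iff)
      have "(\<Sum>j<r div 2. c / \<bar>\<Prod>l\<in>{..<r} - {2 * j + 1}. x (2 * j + 1) - x l\<bar> / (real k - x (2 * j + 1)))
        = (\<Sum>j<L. - (H (m j) / M j / (real k - m j)))"
        unfolding L_def[symmetric] using weight xo by (intro sum.cong refl) simp
      also have "\<dots> = real k - a"
        using a[OF k k'] by (simp add: sum_negf H_def M_def del: prod.lessThan_Suc)
      finally show ?thesis .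
    qed
  qed
qed

text \<open>By completeness, passing to coordinates in the basis \<open>t\<close> preserves inner
  products.\<close>

lemma orthonormal_Parseval:
  fixes t :: "nat \<Rightarrow> nat \<Rightarrow> real"
  assumes on: "\<And>k l. k < r \<Longrightarrow> l < r \<Longrightarrow> (\<Sum>i<r. t k i * t l i) = (if k = l then 1 else 0)"
  shows "(\<Sum>l<r. (\<Sum>i<r. t l i * p i) * (\<Sum>i<r. t l i * q i)) = (\<Sum>i<r. p i * q i)"
proof -
  have "(\<Sum>l<r. (\<Sum>i<r. t l i * p i) * (\<Sum>i<r. t l i * q i)) =
    (\<Sum>l<r. \<Sum>i<r. \<Sum>j<r. p i * q j * (t l i * t l j))"
    by (simp add: sum_product mult_ac)
  also have "\<dots> = (\<Sum>i<r. \<Sum>j<r. \<Sum>l<r. p i * q j * (t l i * t l j))"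
    by (subst sum.swap) (intro sum.cong refl sum.swap)
  also have "\<dots> = (\<Sum>i<r. \<Sum>j<r. p i * q j * (if i = j then 1 else 0))"
    using orthonormal_complete[OF on] by (intro sum.cong refl) (simp add: sum_distrib_left[symmetric])
  also have "\<dots> = (\<Sum>i<r. p i * q i)"
    by (intro sum.cong refl) (simp add: if_distrib[of "\<lambda>z. _ * z"] cong: if_cong)
  finally show ?thesis .
qed

text \<open>An eigenvalue \<open>k\<close> has two sources. Index \<open>2 * k\<close> belongs to a
  root of the secular equation, where \<open>k - a\<close> equals the sum of the
  \<open>g i ^ 2 / (k - x i)\<close>. Index \<open>2 * k + 1\<close> belongs to the unit vector at
  the node with \<open>x i = k\<close>, where the border vanishes. The equivalence in the last
  conclusion also makes the eigenvectors nonzero.\<close>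

lemma cycle_matrix_spectrum:
  assumes N: "N \<ge> 3"
  obtains A u :: "nat \<Rightarrow> nat \<Rightarrow> real" where
    "\<And>k l. A k l = A l k"
    "\<And>k l. k < N \<Longrightarrow> l < N \<Longrightarrow> k \<noteq> l \<Longrightarrow> A k l \<noteq> 0 \<longleftrightarrow> adj (cycle_graph N) k l"
    "\<And>j k. j < N \<Longrightarrow> k < N \<Longrightarrow> (\<Sum>l<N. A k l * u j l) = real (j div 2) * u j k"
    "\<And>i j. i < N \<Longrightarrow> j < N \<Longrightarrow> (\<Sum>k<N. u i k * u j k) = 0 \<longleftrightarrow> i \<noteq> j"
proof -
  obtain r where Nr: "N = Suc r" using N by (cases N) auto
  have r: "r \<ge> 2" using N Nr by simp
  obtain x :: "nat \<Rightarrow> real" and c a where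
    mono: "\<And>i j. i < j \<Longrightarrow> j < r \<Longrightarrow> x i < x j" and
    xe: "\<And>l. 2 * l < r \<Longrightarrow> x (2 * l) = real l" and
    xo: "\<And>i l. i < r \<Longrightarrow> odd i \<Longrightarrow> x i \<noteq> real l" and
    c: "c > 0" and
    secular: "\<And>k. 2 * k \<le> r \<Longrightarrow> (\<Sum>j<r div 2. c / \<bar>\<Prod>l\<in>{..<r} - {2 * j + 1}. x (2 * j + 1) - x l\<bar> /
      (real k - x (2 * j + 1))) = real k - a"
    using interlacing_nodes_exist[OF r] by blast
  have inj: "inj_on x {..<r}"
    by (intro strict_mono_on_imp_inj_on strict_mono_onI) (use mono in auto)
  define D where "D i = (\<Prod>j\<in>{..<r} - {i}. x i - x j)" for i
  define w where "w i = 1 / \<bar>D i\<bar>" for i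
  obtain t c0 c1 where
    on: "\<And>k l. k < r \<Longrightarrow> l < r \<Longrightarrow> (\<Sum>i<r. t k i * t l i) = (if k = l then 1 else 0)" and
    far: "\<And>k l. k + 1 < l \<Longrightarrow> l < r \<Longrightarrow> (\<Sum>i<r. x i * t k i * t l i) = 0" and
    near: "\<And>k. k + 1 < r \<Longrightarrow> (\<Sum>i<r. x i * t k i * t (k + 1) i) \<noteq> 0" and
    first: "\<And>i. i < r \<Longrightarrow> sqrt (w i) = c0 * t 0 i" and
    last: "\<And>i. i < r \<Longrightarrow> sgn (D i) * sqrt (w i) = c1 * t (r - 1) i" and
    c01: "c0 \<noteq> 0" "c1 \<noteq> 0"
    using Jacobi_basis_exists[OF inj r] unfolding w_def D_def by blast
  \<comment> \<open>The border is supported on the odd-indexed nodes, and its squares are the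
    numerators \<open>c / \<bar>D i\<bar>\<close> in \<open>secular\<close>.\<close>
  define g where "g i = (if odd i then sqrt c * sqrt (w i) else 0)" for i
  define h where "h k = (\<Sum>i<r. g i * t k i)" for k
  \<comment> \<open>Since the sign of \<open>D i\<close> alternates, the restriction of
    \<open>sqrt (w i)\<close> to odd \<open>i\<close> is half the difference of
    \<open>sqrt (w i)\<close> and, up to a global sign, the signed weight vector.\<close>
  have g: "g i = sqrt c / 2 * (c0 * t 0 i - (- 1) ^ (r - 1) * c1 * t (r - 1) i)" if i: "i < r" for i
  proof -
    have "(- 1 :: real) ^ (r - 1) * (- 1) ^ (r - 1 - i) = (- 1) ^ ((r - 1 - i) + (r - 1 - i) + i)"
      using i by (simp add: power_add[symmetric])
    also have "\<dots> = (- 1) ^ i" by (simp add: power_add)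
    finally have "(- 1) ^ (r - 1) * sgn (D i) = (- 1) ^ i"
      using sgn_prod_differences[of r x i, OF mono i] by (simp add: D_def)
    then have "(- 1) ^ (r - 1) * (sgn (D i) * sqrt (w i)) = (- 1) ^ i * sqrt (w i)"
      by (simp add: mult.assoc[symmetric])
    then have e: "(- 1) ^ (r - 1) * (c1 * t (r - 1) i) = (- 1) ^ i * (c0 * t 0 i)"
      by (simp only: last[OF i, symmetric] first[OF i, symmetric])
    show ?thesis
      unfolding mult.assoc e by (simp add: g_def first[OF i])
  qed
  \<comment> \<open>In the basis \<open>t\<close> the border has only a first and a last coordinate,
    which are distinct as \<open>r \<ge> 2\<close>. They are the two edges at vertex
    \<open>r\<close>.\<close>
  have h: "h k \<noteq> 0 \<longleftrightarrow> k = 0 \<or> k = r - 1" if k: "k < r" for k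
  proof -
    have "h k = (\<Sum>i<r. sqrt c / 2 * (c0 * (t 0 i * t k i) - (- 1) ^ (r - 1) * c1 * (t (r - 1) i * t k i)))"
      unfolding h_def by (intro sum.cong refl) (simp add: g algebra_simps)
    also have "\<dots> = sqrt c / 2 * (c0 * (\<Sum>i<r. t 0 i * t k i) - (- 1) ^ (r - 1) * c1 * (\<Sum>i<r. t (r - 1) i * t k i))"
      by (simp add: sum_distrib_left sum_subtractf right_diff_distrib)
    also have "\<dots> = sqrt c / 2 * (c0 * (if k = 0 then 1 else 0) - (- 1) ^ (r - 1) * c1 * (if k = r - 1 then 1 else 0))"
    proof -
      have "(\<Sum>i<r. t 0 i * t k i) = (if k = 0 then 1 else 0)" using on[of 0 k] k by auto
      moreover have "(\<Sum>i<r. t (r - 1) i * t k i) = (if k = r - 1 then 1 else 0)"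
        using on[of "r - 1" k] k by auto
      ultimately show ?thesis by simp
    qed
    finally show ?thesis using c c01 r by (auto split: if_splits)
  qed
  define A where "A k l = (if k < r \<and> l < r then \<Sum>i<r. x i * t k i * t l i
    else if k < r then h k else if l < r then h l else a)" for k l
  \<comment> \<open>\<open>(z j, \<zeta> j)\<close> is an eigenvector of the arrow matrix with diagonal \<open>(x, a)\<close> and border \<open>g\<close>;
    \<open>A\<close> is this matrix in the orthonormal basis formed by the \<open>t k\<close> and the last unit vector.\<close>
  define z where "z j i = (if even j then (if odd i then g i / (real (j div 2) - x i) else 0)
    else if i = j - 1 then 1 else 0)" for j i
  define \<zeta> where "\<zeta> j = (if even j then 1 else 0 :: real)" for j :: nat
  define u where "u j l = (if l < r then \<Sum>i<r. t l i * z j i else \<zeta> j)" for j l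
  \<comment> \<open>\<open>E1\<close> gives the node rows and \<open>E2\<close> the border row of
    the eigenvalue equation; for even \<open>j\<close> the latter is the secular equation.\<close>
  have E1: "x i * z j i + g i * \<zeta> j = real (j div 2) * z j i" if j: "j < N" and i: "i < r" for i j
  proof (cases "even j")
    case True
    then show ?thesis
      using xo[OF i, of "j div 2"] by (auto simp: z_def \<zeta>_def g_def field_simps)
  next
    case False
    then have "j - 1 = 2 * (j div 2)" by presburger
    then show ?thesis
      using False xe[of "j div 2"] i by (auto simp: z_def \<zeta>_def)
  qed
  have E2: "(\<Sum>i<r. g i * z j i) + a * \<zeta> j = real (j div 2) * \<zeta> j" if j: "j < N" for j
  proof (cases "even j")
    case True
    let ?f = "\<lambda>i. c / \<bar>D i\<bar> / (real (j div 2) - x i)"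
    have "(\<Sum>i<r. g i * z j i) = (\<Sum>i\<in>(\<lambda>l. 2 * l + 1) ` {..<r div 2}. ?f i)"
    proof (rule sum.mono_neutral_cong_right)
      show "\<forall>i\<in>{..<r} - (\<lambda>l. 2 * l + 1) ` {..<r div 2}. g i * z j i = 0"
      proof
        fix i assume i: "i \<in> {..<r} - (\<lambda>l. 2 * l + 1) ` {..<r div 2}"
        have "even i"
        proof (rule ccontr)
          assume "odd i"
          then have "i = 2 * (i div 2) + 1" "i div 2 < r div 2" using i by auto presburger+
          then show False using i by blast
        qed
        then show "g i * z j i = 0" by (simp add: g_def)
      qed
      fix i assume "i \<in> (\<lambda>l. 2 * l + 1) ` {..<r div 2}"
      then have "odd i" by auto
      then have "g i * g i = c / \<bar>D i\<bar>"
        using c by (simp add: g_def w_def real_sqrt_mult[symmetric] abs_mult)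
      then show "g i * z j i = ?f i" using True \<open>odd i\<close> by (simp add: z_def)
    qed auto
    also have "\<dots> = (\<Sum>l<r div 2. ?f (2 * l + 1))"
      by (subst sum.reindex) (auto simp: inj_on_def)
    also have "\<dots> = real (j div 2) - a"
      using secular[of "j div 2"] j Nr True unfolding D_def by auto
    finally show ?thesis using True by (simp add: \<zeta>_def)
  next
    case False
    then have "g i * z j i = 0" for i by (auto simp: g_def z_def)
    then show ?thesis using False by (simp add: \<zeta>_def)
  qed
  define ip where "ip i j = (\<Sum>k<r. z i k * z j k) + \<zeta> i * \<zeta> j" for i j
  \<comment> \<open>The right-hand side is symmetric in \<open>i\<close> and \<open>j\<close>, which
    makes eigenvectors for distinct eigenvalues orthogonal.\<close>
  have ip_eig: "real (i div 2) * ip i j = (\<Sum>k<r. x k * z i k * z j k) + (\<Sum>k<r. g k * z j k) * \<zeta> i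
      + (\<Sum>k<r. g k * z i k) * \<zeta> j + a * \<zeta> i * \<zeta> j" if "i < N" for i j
  proof -
    have "real (i div 2) * ip i j = (\<Sum>k<r. (real (i div 2) * z i k) * z j k) + (real (i div 2) * \<zeta> i) * \<zeta> j"
      by (simp add: ip_def algebra_simps sum_distrib_left)
    also have "\<dots> = (\<Sum>k<r. (x k * z i k + g k * \<zeta> i) * z j k) + ((\<Sum>k<r. g k * z i k) + a * \<zeta> i) * \<zeta> j"
      using E1[OF that] E2[OF that] by simp
    also have "\<dots> = (\<Sum>k<r. x k * z i k * z j k) + (\<Sum>k<r. g k * z j k) * \<zeta> i
      + (\<Sum>k<r. g k * z i k) * \<zeta> j + a * \<zeta> i * \<zeta> j"
      by (simp add: algebra_simps sum.distrib sum_distrib_left)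
    finally show ?thesis .
  qed
  have ip_sym: "ip i j = ip j i" for i j by (simp add: ip_def mult_ac)
  have ip_0: "ip i j = 0 \<longleftrightarrow> i \<noteq> j" if i: "i < N" and j: "j < N" for i j
  proof -
    consider "i div 2 \<noteq> j div 2" | "i = j" | "i div 2 = j div 2" "i \<noteq> j" by blast
    then show ?thesis
    proof cases
      case 1
      have "real (i div 2) * ip i j = real (j div 2) * ip j i"
        unfolding ip_eig[OF i] ip_eig[OF j] by (simp add: mult_ac)
      then have "ip i j = 0" using 1 by (simp add: ip_sym[of j i])
      then show ?thesis using 1 by auto
    next
      case 2
      have "ip j j > 0"
      proof (cases "even j")
        case True
        then show ?thesis unfolding ip_def \<zeta>_def
          by (intro add_nonneg_pos sum_nonneg) auto
      next
        case False
        then have "j - 1 < r" using j Nr r by simp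
        then show ?thesis unfolding ip_def \<zeta>_def
          using False by (intro add_pos_nonneg sum_pos2[of _ "j - 1"]) (auto simp: z_def)
      qed
      then show ?thesis using 2 by simp
    next
      case 3
      \<comment> \<open>Opposite parity gives disjoint supports: odd-indexed nodes and the last
        coordinate against one even-indexed node.\<close>
      then have par: "even i \<noteq> even j" by presburger
      have z0: "z j' k = 0" if "even j' = even k" for j' k
        using that by (cases "even j'") (auto simp: z_def)
      have "z i k * z j k = 0" for k
        using z0[of i k] z0[of j k] par by (cases "even i = even k") auto
      moreover have "\<zeta> i * \<zeta> j = 0" using par by (auto simp: \<zeta>_def)
      ultimately show ?thesis using 3 by (simp add: ip_def)
    qed
  qed
  show thesis
  proof
    show "A k l = A l k" for k l by (simp add: A_def mult_ac)
    have path: "A k l \<noteq> 0 \<longleftrightarrow> l = k + 1" if "k < l" "l < r" for k l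
      using that far[of k l] near[of k] by (cases "l = k + 1") (auto simp: A_def)
    show "A k l \<noteq> 0 \<longleftrightarrow> adj (cycle_graph N) k l" if kl: "k < N" "l < N" "k \<noteq> l" for k l
      using kl
    proof (induction k l rule: linorder_wlog)
      case (le k l)
      then have kr: "k < r" using Nr by simp
      have "adj (cycle_graph N) k l \<longleftrightarrow> l = k + 1 \<or> k = 0 \<and> l = r"
        using le Nr by (auto simp: adj_cycle_graph_iff)
      moreover have "A k l \<noteq> 0 \<longleftrightarrow> l = k + 1 \<or> k = 0 \<and> l = r"
      proof (cases "l < r")
        case True
        then show ?thesis using path[of k l] le by auto
      next
        case False
        then have "l = r" using le Nr by simp
        then show ?thesis using h[OF kr] kr by (auto simp: A_def)
      qed
      ultimately show ?case by simp
    next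
      case (sym k l)
      then show ?case using \<open>\<And>k l. A k l = A l k\<close> by (metis insert_commute)
    qed
    show "(\<Sum>l<N. A k l * u j l) = real (j div 2) * u j k" if j: "j < N" and k: "k < N" for j k
    proof (cases "k < r")
      case True
      \<comment> \<open>Parseval turns the sum over the basis index \<open>l\<close> back into a sum
        over the nodes, where \<open>E1\<close> applies.\<close>
      have "(\<Sum>l<r. A k l * u j l) = (\<Sum>l<r. (\<Sum>i<r. t l i * (x i * t k i)) * (\<Sum>i<r. t l i * z j i))"
        using True by (simp add: A_def u_def mult_ac)
      also have "\<dots> = (\<Sum>i<r. x i * t k i * z j i)" by (rule orthonormal_Parseval[OF on])
      finally have "(\<Sum>l<N. A k l * u j l) = (\<Sum>i<r. x i * t k i * z j i) + (\<Sum>i<r. g i * t k i) * \<zeta> j"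
        using True by (simp add: Nr A_def u_def h_def)
      also have "\<dots> = (\<Sum>i<r. t k i * (x i * z j i + g i * \<zeta> j))"
        by (simp add: algebra_simps sum.distrib sum_distrib_left)
      also have "\<dots> = (\<Sum>i<r. t k i * (real (j div 2) * z j i))" using E1[OF j] by simp
      finally show ?thesis using True by (simp add: u_def sum_distrib_left mult_ac)
    next
      case False
      then have kr: "k = r" using k Nr by simp
      have "(\<Sum>l<r. A k l * u j l) = (\<Sum>l<r. (\<Sum>i<r. t l i * g i) * (\<Sum>i<r. t l i * z j i))"
        by (simp add: kr A_def u_def h_def mult_ac)
      also have "\<dots> = (\<Sum>i<r. g i * z j i)" by (rule orthonormal_Parseval[OF on])
      finally show ?thesis using E2[OF j] by (simp add: Nr kr A_def u_def)
    qed
    show "(\<Sum>k<N. u i k * u j k) = 0 \<longleftrightarrow> i \<noteq> j" if "i < N" "j < N" for i j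
    proof -
      have "(\<Sum>k<N. u i k * u j k) = ip i j"
        using orthonormal_Parseval[OF on, of "z i" "z j"] by (simp add: Nr u_def ip_def)
      then show ?thesis using ip_0[OF that] by simp
    qed
  qed
qed

section \<open>The torus\<close>

text \<open>The tensor product of eigenvector \<open>k\<close> of \<open>A\<close> and eigenvector
  \<open>l\<close> of \<open>B\<close> is multiplied by \<open>l div 2 - k div 2\<close> (as a real
  number), so the counted pairs give kernel vectors. Their inner products factor, hence they are
  orthogonal and nonzero.\<close>

lemma max_nullity_torus_ge:
  assumes n: "n \<ge> 3" and m: "m \<ge> 3"
  shows "card {(k, l). k < n \<and> l < m \<and> k div 2 = l div 2} \<le> max_nullity (cycle_graph n \<box> cycle_graph m)"
proof -
  let ?G = "cycle_graph n \<box> cycle_graph m"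
  let ?V = "{..<n} \<times> {..<m}"
  let ?S = "{(k, l). k < n \<and> l < m \<and> k div 2 = l div 2}"
  obtain A u where A: "\<And>k l. A k l = A l k"
    "\<And>k l. k < n \<Longrightarrow> l < n \<Longrightarrow> k \<noteq> l \<Longrightarrow> A k l \<noteq> 0 \<longleftrightarrow> adj (cycle_graph n) k l"
    "\<And>j k. j < n \<Longrightarrow> k < n \<Longrightarrow> (\<Sum>l<n. A k l * u j l) = real (j div 2) * u j k"
    "\<And>i j. i < n \<Longrightarrow> j < n \<Longrightarrow> (\<Sum>k<n. u i k * u j k) = 0 \<longleftrightarrow> i \<noteq> j"
    using cycle_matrix_spectrum[OF n] by blast
  obtain B v where B: "\<And>k l. B k l = B l k"
    "\<And>k l. k < m \<Longrightarrow> l < m \<Longrightarrow> k \<noteq> l \<Longrightarrow> B k l \<noteq> 0 \<longleftrightarrow> adj (cycle_graph m) k l"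
    "\<And>j k. j < m \<Longrightarrow> k < m \<Longrightarrow> (\<Sum>l<m. B k l * v j l) = real (j div 2) * v j k"
    "\<And>i j. i < m \<Longrightarrow> j < m \<Longrightarrow> (\<Sum>k<m. v i k * v j k) = 0 \<longleftrightarrow> i \<noteq> j"
    using cycle_matrix_spectrum[OF m] by blast
  define N where "N = card (verts ?G)"
  obtain f where f: "bij_betw f {..<N} ?V"
    using ex_bij_betw_nat_finite[of ?V] by (auto simp: N_def verts_torus atLeast0LessThan)
  have fV: "f p \<in> ?V" if "p < N" for p using bij_betwE[OF f] that by blast
  have sum_f: "(\<Sum>p<N. F (f p)) = (\<Sum>g<n. \<Sum>h<m. F (g, h))" for F :: "nat \<times> nat \<Rightarrow> real"
    by (simp add: sum.reindex_bij_betw[OF f, of F] sum.cartesian_product)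
  define K where "K a b = (if fst a = fst b then B (snd a) (snd b) else 0) -
    (if snd a = snd b then A (fst a) (fst b) else 0)" for a b
  define M where "M = mat N N (\<lambda>(p, q). K (f p) (f q))"
  define X where "X s = vec N (\<lambda>p. u (fst s) (fst (f p)) * v (snd s) (snd (f p)))" for s
  have Mc: "M \<in> carrier_mat N N" by (simp add: M_def)
  have MG: "M \<in> sym_matrices ?G f"
  proof -
    have "K a b = K b a" for a b using A(1) B(1) by (auto simp: K_def)
    then have "M\<^sup>T = M" unfolding M_def by (intro eq_matI) auto
    moreover have "M $$ (p, q) \<noteq> 0 \<longleftrightarrow> adj ?G (f p) (f q)" if "p < N" "q < N" "p \<noteq> q" for p q
    proof -
      obtain g h g' h' where gh: "f p = (g, h)" "f q = (g', h')" by (metis surj_pair)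
      have bd: "g < n" "h < m" "g' < n" "h' < m" using fV[of p] fV[of q] that gh by auto
      \<comment> \<open>Distinct vertices share at most one coordinate, so at most one of the two
        terms of \<open>K\<close> is present and nothing cancels.\<close>
      have "(g, h) \<noteq> (g', h')"
        using inj_onD[OF bij_betw_imp_inj_on[OF f], of p q] that gh by auto
      moreover have "\<not> adj (cycle_graph n) g g" "\<not> adj (cycle_graph m) h h"
        using n m simple_graph_cycle_graph[of n] simple_graph_cycle_graph[of m]
        by (auto simp: simple_graph_def doubleton_eq_iff)
      ultimately have "K (g, h) (g', h') \<noteq> 0 \<longleftrightarrow> adj ?G (g, h) (g', h')"
        using A(2)[of g g'] B(2)[of h h'] bd
        by (cases "g = g'"; cases "h = h'") (auto simp: K_def adj_box_prod verts_torus)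
      then show ?thesis using that gh by (simp add: M_def)
    qed
    ultimately show ?thesis using Mc unfolding sym_matrices_def N_def by blast
  qed
  have "card ?S \<le> kernel_dim M"
  proof (rule card_le_kernel_dim[OF Mc])
    show "X s \<in> carrier_vec N" for s by (simp add: X_def)
    show "M *\<^sub>v X s = 0\<^sub>v N" if "s \<in> ?S" for s
    proof (rule eq_vecI)
      obtain k l where kl: "s = (k, l)" "k < n" "l < m" "k div 2 = l div 2" using \<open>s \<in> ?S\<close> by auto
      fix p assume "p < dim_vec (0\<^sub>v N :: real vec)"
      then have p: "p < N" by simp
      obtain g h where gh: "f p = (g, h)" "g < n" "h < m" using fV[OF p] by auto
      have "(M *\<^sub>v X s) $ p = (\<Sum>q<N. K (f p) (f q) * (u k (fst (f q)) * v l (snd (f q))))"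
        using p by (simp add: M_def X_def scalar_prod_def atLeast0LessThan kl)
      also have "\<dots> = (\<Sum>g'<n. \<Sum>h'<m. K (g, h) (g', h') * (u k g' * v l h'))"
        unfolding gh(1) by (subst sum_f[of "\<lambda>a. K (g, h) a * (u k (fst a) * v l (snd a))"]) simp
      also have "\<dots> = (\<Sum>g'<n. \<Sum>h'<m. if g = g' then B h h' * (u k g' * v l h') else 0) -
          (\<Sum>g'<n. \<Sum>h'<m. if h = h' then A g g' * (u k g' * v l h') else 0)"
        unfolding sum_subtractf[symmetric] by (intro sum.cong refl) (simp add: K_def left_diff_distrib)
      also have "(\<Sum>g'<n. \<Sum>h'<m. if g = g' then B h h' * (u k g' * v l h') else 0)
          = u k g * (\<Sum>h'<m. B h h' * v l h')"
        using gh(2) by (subst sum.swap) (simp add: sum_distrib_left mult_ac)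
      also have "(\<Sum>g'<n. \<Sum>h'<m. if h = h' then A g g' * (u k g' * v l h') else 0)
          = (\<Sum>g'<n. A g g' * u k g') * v l h"
        using gh(3) by (simp add: sum_distrib_right mult.assoc)
      finally show "(M *\<^sub>v X s) $ p = 0\<^sub>v N $ p"
        using A(3)[OF kl(2) gh(2)] B(3)[OF kl(3) gh(3)] kl(4) p by simp
    qed (simp add: M_def)
    show "X s \<bullet> X t = 0 \<longleftrightarrow> s \<noteq> t" if "s \<in> ?S" "t \<in> ?S" for s t
    proof -
      obtain k l k' l' where kl: "s = (k, l)" "t = (k', l')" "k < n" "l < m" "k' < n" "l' < m"
        using \<open>s \<in> ?S\<close> \<open>t \<in> ?S\<close> by auto
      have "X s \<bullet> X t = (\<Sum>p<N. u k (fst (f p)) * v l (snd (f p)) * (u k' (fst (f p)) * v l' (snd (f p))))"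
        by (simp add: X_def scalar_prod_def atLeast0LessThan kl)
      also have "\<dots> = (\<Sum>g<n. \<Sum>h<m. u k g * v l h * (u k' g * v l' h))"
        by (subst sum_f[of "\<lambda>a. u k (fst a) * v l (snd a) * (u k' (fst a) * v l' (snd a))"]) simp
      also have "\<dots> = (\<Sum>g<n. u k g * u k' g) * (\<Sum>h<m. v l h * v l' h)"
        by (simp add: sum_product mult_ac)
      finally show ?thesis
        using A(4)[OF kl(3,5)] B(4)[OF kl(4,6)] kl(1,2) by auto
    qed
  qed
  also have "\<dots> \<le> max_nullity ?G"
    unfolding max_nullity_def
  proof (rule Max_ge[OF finite_nullities])
    have "labelling ?G f" using f by (simp add: labelling_def N_def verts_torus)
    then show "kernel_dim M \<in> {kernel_dim A |A f. labelling ?G f \<and> A \<in> sym_matrices ?G f}"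
      using MG by blast
  qed
  finally show ?thesis .
qed

text \<open>Each \<open>k < n\<close> has the two partners \<open>2 * (k div 2)\<close> and
  \<open>2 * (k div 2) + 1\<close>; the second is missing only for \<open>k = n - 1\<close> when
  \<open>m = n\<close> is odd.\<close>

lemma card_pairs_same_half:
  assumes "n \<le> m"
  shows "card {(k, l). k < n \<and> l < m \<and> k div 2 = l div 2} = (if m = n \<and> odd n then 2 * n - 1 else 2 * n)"
proof -
  let ?T = "\<lambda>k. {l. l < m \<and> k div 2 = l div 2}"
  have two: "card (?T k) = 2" if "2 * (k div 2) + 1 < m" for k
  proof -
    have "?T k = {2 * (k div 2), 2 * (k div 2) + 1}" using that by auto
    then show ?thesis by simp
  qed
  have "{(k, l). k < n \<and> l < m \<and> k div 2 = l div 2} = Sigma {..<n} ?T" by auto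
  then have eq: "card {(k, l). k < n \<and> l < m \<and> k div 2 = l div 2} = (\<Sum>k<n. card (?T k))"
    by (simp add: card_SigmaI)
  show ?thesis
  proof (cases "m = n \<and> odd n")
    case True
    then obtain n' where n': "n = Suc n'" "even n'" by (cases n) auto
    have "?T n' = {n'}" using True n' by auto
    then have last: "card (?T n') = 1" by simp
    have "2 * (k div 2) + 1 < m" if "k < n'" for k using that True n' by presburger
    then have "(\<Sum>k<n'. card (?T k)) = (\<Sum>k<n'. 2)" using two by (intro sum.cong) auto
    then show ?thesis using eq True n' last by simp
  next
    case False
    have "2 * (k div 2) + 1 < m" if "k < n" for k using that assms False by presburger
    then have "(\<Sum>k<n. card (?T k)) = (\<Sum>k<n. 2)" using two by (intro sum.cong) auto
    then show ?thesis unfolding eq using False by auto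
  qed
qed

theorem theorem2p6:
  fixes n m :: nat
  assumes "n \<ge> 3" and "m \<ge> n"
  shows "max_nullity (cycle_graph n \<box> cycle_graph m) = zero_forcing_number (cycle_graph n \<box> cycle_graph m) \<and>
    zero_forcing_number (cycle_graph n \<box> cycle_graph m) = (if m = n \<and> odd n then 2 * n - 1 else 2 * n)"
proof -
  have m: "m \<ge> 3" using assms by simp
  let ?c = "if m = n \<and> odd n then 2 * n - 1 else 2 * n"
  have "?c \<le> max_nullity (cycle_graph n \<box> cycle_graph m)"
    using max_nullity_torus_ge[OF assms(1) m] card_pairs_same_half[OF assms(2)] by simp
  moreover have "max_nullity (cycle_graph n \<box> cycle_graph m) \<le> zero_forcing_number (cycle_graph n \<box> cycle_graph m)"
    by (rule max_nullity_le_zero_forcing_number[OF simple_graph_torus[OF assms(1) m]])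
  moreover have "zero_forcing_number (cycle_graph n \<box> cycle_graph m) \<le> ?c"
    using zero_forcing_number_torus_le[OF assms(1) m] zero_forcing_number_odd_torus_le[OF assms(1)] by auto
  ultimately show ?thesis by simp
qed

end
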